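(* Let $F:\mathbb{R}\to\mathbb{R}$ be analytic. The equation $$\ddot u\,u+\tfrac12\dot u^2+F'(u)=0$$ cannot admit both peaked TWS and compactly supported TWS for the same $F$. In particular, a peaked TWS cannot have compact support, and conversely, a TWS with compact support cannot have peaks.
   Context: Throughout, only solutions with values in $\{u\ge 0\}$ are considered. Traveling wave solution (TWS): a bounded function $u\in H^1_{loc}(\mathbb{R})$ satisfying the equation $\ddot u\,u+\frac12\dot u^2+F'(u)=0$ in the sense of distributions, i.e. $$\int_{\mathbb{R}}(u^2)_t\phi_t+(u_t)^2\phi-2F'(u)\phi\,dt=0\quad\text{for all }\phi\in C_c^\infty(\mathbb{R}).$$ The TWS considered are singular TWS: non-constant TWS $u$ for which there is a single constant $h\in\mathbb{R}$ such that either $u$ is a classical solution on $\mathbb{R}$ of $\frac{u\dot u^2}{2}+F(u)=h$, or $u$ is a classical solution of this equation on $\mathbb{R}\setminus\mathcal{S}$, where $\mathcal{S}$ is a countable set of points $t_k$ at which $\lim_{t\to t_k}\big(\frac{u(t)\dot u(t)^2}{2}+F(u(t))\big)=h$. A TWS $u:\mathbb{R}\to\mathbb{R}$ is called peaked if it is smooth except at a nonempty finite or countable set of points (peaks) $\{t_k\}$, where $$0\neq\lim_{t\to t_k^+}u'(t)=-\lim_{t\to t_k^-}u'(t)\neq\pm\infty.$$ A TWS $u$ has compact support (is compactly supported) if there exist $-\infty<t_1<t_2<\infty$ such that $u$ is constant on $\mathbb{R}\setminus[t_1,t_2]$ and non-constant on $[t_1,t_2]$. *)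

theory Defs
  imports "HOL-Analysis.Analysis"
begin

definition real_analytic :: "(real \<Rightarrow> real) \<Rightarrow> bool" where
  "real_analytic F \<longleftrightarrow> (\<forall>x. \<exists>A. (\<lambda>y. F (x + y)) has_fps_expansion A)"

(* The open superset makes all iterated derivatives genuine near each point of S,
   also when S itself is not known to be open. *)
definition smooth_on :: "real set \<Rightarrow> (real \<Rightarrow> real) \<Rightarrow> bool" where
  "smooth_on S f \<longleftrightarrow>
     (\<exists>U. open U \<and> S \<subseteq> U \<and> (\<forall>n. (deriv ^^ n) f differentiable_on U))"

definition test_function :: "(real \<Rightarrow> real) \<Rightarrow> bool" where
  "test_function \<phi> \<longleftrightarrow> smooth_on UNIV \<phi> \<and> (\<exists>K. compact K \<and> (\<forall>t. t \<notin> K \<longrightarrow> \<phi> t = 0))"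

definition loc_integrable :: "(real \<Rightarrow> real) \<Rightarrow> bool" where
  "loc_integrable f \<longleftrightarrow> (\<forall>a b. set_integrable lborel {a..b} f)"

definition has_weak_deriv :: "(real \<Rightarrow> real) \<Rightarrow> (real \<Rightarrow> real) \<Rightarrow> bool" where
  "has_weak_deriv f g \<longleftrightarrow> loc_integrable f \<and> loc_integrable g \<and>
     (\<forall>\<phi>. test_function \<phi> \<longrightarrow>
        (LINT t|lborel. f t * deriv \<phi> t) = - (LINT t|lborel. g t * \<phi> t))"

(* Elements of the Sobolev space are classes modulo null sets; u is taken to be the
   continuous representative, so that pointwise properties of u make sense.  Measurability
   of u and v is part of has_weak_deriv. *)
definition H1_loc :: "(real \<Rightarrow> real) \<Rightarrow> bool" where
  "H1_loc u \<longleftrightarrow> continuous_on UNIV u \<and> loc_integrable (\<lambda>t. (u t)\<^sup>2) \<and>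
     (\<exists>v. has_weak_deriv u v \<and> loc_integrable (\<lambda>t. (v t)\<^sup>2))"

(* v and w stand for the weak derivatives of u and u^2, which are unique up to null sets. *)
definition TWS :: "(real \<Rightarrow> real) \<Rightarrow> (real \<Rightarrow> real) \<Rightarrow> bool" where
  "TWS F u \<longleftrightarrow> (\<forall>t. 0 \<le> u t) \<and> bounded (range u) \<and> H1_loc u \<and>
     (\<exists>v w. has_weak_deriv u v \<and> has_weak_deriv (\<lambda>t. (u t)\<^sup>2) w \<and>
       (\<forall>\<phi>. test_function \<phi> \<longrightarrow>
          (LINT t|lborel. w t * deriv \<phi> t + (v t)\<^sup>2 * \<phi> t - 2 * deriv F (u t) * \<phi> t) = 0))"

definition energy :: "(real \<Rightarrow> real) \<Rightarrow> (real \<Rightarrow> real) \<Rightarrow> real \<Rightarrow> real" where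
  "energy F u t = u t * (deriv u t)\<^sup>2 / 2 + F (u t)"

definition classical_energy_solution ::
    "(real \<Rightarrow> real) \<Rightarrow> real \<Rightarrow> real set \<Rightarrow> (real \<Rightarrow> real) \<Rightarrow> bool" where
  "classical_energy_solution F h A u \<longleftrightarrow>
     (\<forall>t\<in>A. u differentiable (at t)) \<and> continuous_on A (deriv u) \<and> (\<forall>t\<in>A. energy F u t = h)"

(* The limit at a point of S is taken through the complement of S, because u need not be
   differentiable at the other points of S, and these may accumulate. *)
definition singular_TWS :: "(real \<Rightarrow> real) \<Rightarrow> (real \<Rightarrow> real) \<Rightarrow> bool" where
  "singular_TWS F u \<longleftrightarrow> TWS F u \<and> \<not> u constant_on UNIV \<and>
     (\<exists>h. classical_energy_solution F h UNIV u \<or>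
        (\<exists>S. countable S \<and> classical_energy_solution F h (- S) u \<and>
           (\<forall>t\<in>S. (energy F u \<longlongrightarrow> h) (at t within - S))))"

(* Differentiability in a punctured neighbourhood keeps the limits from involving
   the unspecified values of deriv. *)
definition is_peak :: "(real \<Rightarrow> real) \<Rightarrow> real \<Rightarrow> bool" where
  "is_peak u t \<longleftrightarrow> (\<forall>\<^sub>F s in at t. u differentiable (at s)) \<and>
     (\<exists>a. a \<noteq> 0 \<and> (deriv u \<longlongrightarrow> a) (at_right t) \<and> (deriv u \<longlongrightarrow> - a) (at_left t))"

definition peaked :: "(real \<Rightarrow> real) \<Rightarrow> bool" where
  "peaked u \<longleftrightarrow> (\<exists>P. P \<noteq> {} \<and> countable P \<and> smooth_on (- P) u \<and> (\<forall>t\<in>P. is_peak u t))"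

definition compactly_supported :: "(real \<Rightarrow> real) \<Rightarrow> bool" where
  "compactly_supported u \<longleftrightarrow>
     (\<exists>t1 t2. t1 < t2 \<and> u constant_on (- {t1..t2}) \<and> \<not> u constant_on {t1..t2})"

end

theory Submission
  imports Defs
begin

text \<open>
  The two kinds of waves force incompatible values of \<open>F' 0\<close>: a peak forces \<open>F' 0 < 0\<close>, while a
  compactly supported wave forces \<open>F' 0 = 0\<close>.  All three claims follow at once.

  \<^emph>\<open>Peaks.\<close>  Since \<open>w\<close> is the weak derivative of \<open>u\<^sup>2\<close>, the equation says
  \<open>(u\<^sup>2)'' = v\<^sup>2 - 2 F'(u)\<close> weakly, with a locally integrable right-hand side
  (\<open>TWS_second_weak_deriv\<close>).  Such a function cannot have a kink, because a kink would put a point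
  mass into its second derivative (\<open>loc_integrable_second_deriv_no_kink\<close>).  At a peak with one-sided
  slopes \<open>a\<close> and \<open>- a\<close> the slope of \<open>u\<^sup>2\<close> jumps by \<open>4 a u(t)\<close>, so peaks occur only where \<open>u\<close>
  vanishes (\<open>TWS_zero_at_peak\<close>).  Letting \<open>s\<close> tend to such a point \<open>t\<close> in \<open>u u'\<^sup>2 / 2 + F(u) = h\<close>
  gives first \<open>h = F 0\<close> and then, after division by \<open>u\<close>, \<open>F' 0 = - a\<^sup>2 / 2\<close> (\<open>peak_imp_deriv_neg\<close>).

  \<^emph>\<open>Compact support.\<close>  Let \<open>c\<close> be the value of \<open>u\<close> outside its support.  On an interval where
  \<open>u = c\<close> the equation reduces to \<open>F' c = 0\<close> (\<open>constant_part_critical\<close>), and the energy is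
  \<open>h = F c\<close>.  If \<open>c\<close> were positive, then near \<open>u = c\<close> the energy identity would read
  \<open>u'\<^sup>2 = 2 (F c - F u) / u \<le> L\<^sup>2 (u - c)\<^sup>2\<close>, because \<open>c\<close> is a critical point of \<open>F\<close>.  This is a
  Lipschitz equation for \<open>u - c\<close>, so \<open>u\<close> could never leave the value \<open>c\<close>
  (\<open>singular_TWS_constant_if_positive_part_constant\<close>).  Hence \<open>c = 0\<close> and \<open>F' 0 = 0\<close>.

  Both arguments have to cope with the countable exceptional set of a singular wave, at which
  \<open>u\<close> need not be differentiable.  Its complement is dense, which is all that the limit at a peak
  needs; for the uniqueness argument the mean value inequality still holds in the presence of
  countably many exceptional points (\<open>increment_le_countable_exceptions\<close>).
\<close>

section \<open>Smooth bump functions\<close>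

text \<open>
  The polynomial factor makes this family of functions closed under differentiation;
  \<open>flat_exp 1\<close> is the standard smooth function that vanishes to infinite order at \<open>0\<close>.
\<close>

definition flat_exp :: "real poly \<Rightarrow> real \<Rightarrow> real" where
  "flat_exp p x = (if x > 0 then poly p (1 / x) * exp (- (1 / x)) else 0)"

lemma poly_times_exp_minus_tendsto_0:
  "((\<lambda>y. poly p y * exp (- y)) \<longlongrightarrow> (0::real)) at_top"
proof (induction p)
  case 0
  then show ?case by simp
next
  case (pCons a p)
  have "((\<lambda>y. \<Sum>i\<le>degree (pCons a p). coeff (pCons a p) i * (y ^ i / exp y)) \<longlongrightarrow>
      (\<Sum>i\<le>degree (pCons a p). coeff (pCons a p) i * 0)) at_top"
    by (intro tendsto_intros tendsto_power_div_exp_0)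
  moreover have "(\<Sum>i\<le>degree (pCons a p). coeff (pCons a p) i * (y ^ i / exp y))
      = poly (pCons a p) y * exp (- y)" for y :: real
    by (subst poly_altdef) (simp only: sum_distrib_right exp_minus divide_inverse mult.assoc)
  ultimately show ?case by simp
qed

lemma flat_exp_has_derivative:
  "(flat_exp p has_real_derivative flat_exp ([:0, 0, 1:] * (p - pderiv p)) x) (at x)"
proof -
  consider "x > 0" | "x < 0" | "x = 0" by linarith
  then show ?thesis
  proof cases
    case 1
    have "((\<lambda>x. poly p (1 / x) * exp (- (1 / x))) has_real_derivative
        flat_exp ([:0, 0, 1:] * (p - pderiv p)) x) (at x)"
      using 1 unfolding flat_exp_def
      by (auto intro!: derivative_eq_intros DERIV_chain2[OF poly_DERIV]
               simp: power2_eq_square field_simps)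
    then show ?thesis
      by (rule DERIV_cong_ev[THEN iffD1, OF refl _ refl, rotated])
         (use 1 in \<open>auto simp: flat_exp_def intro: eventually_mono[OF eventually_nhds_in_open[of "{0<..}"]]\<close>)
  next
    case 2
    have "((\<lambda>x. 0) has_real_derivative flat_exp ([:0, 0, 1:] * (p - pderiv p)) x) (at x)"
      using 2 by (simp add: flat_exp_def)
    then show ?thesis
      by (rule DERIV_cong_ev[THEN iffD1, OF refl _ refl, rotated])
         (use 2 in \<open>auto simp: flat_exp_def intro: eventually_mono[OF eventually_nhds_in_open[of "{..<0}"]]\<close>)
  next
    case 3
    have "((\<lambda>h. poly (pCons 0 p) (inverse h) * exp (- inverse h)) \<longlongrightarrow> 0) (at_right 0)"
      by (rule filterlim_compose[OF poly_times_exp_minus_tendsto_0 filterlim_inverse_at_top_right])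
    then have "((\<lambda>h. flat_exp p h / h) \<longlongrightarrow> 0) (at_right 0)"
      by (rule Lim_transform_eventually)
         (auto simp: eventually_at_filter flat_exp_def divide_simps)
    moreover have "((\<lambda>h. flat_exp p h / h) \<longlongrightarrow> 0) (at_left 0)"
      by (rule tendsto_eventually) (auto simp: eventually_at_filter flat_exp_def)
    ultimately have "((\<lambda>h. flat_exp p h / h) \<longlongrightarrow> 0) (at 0)"
      by (rule filterlim_split_at[rotated])
    then show ?thesis
      using 3 by (simp add: DERIV_def flat_exp_def)
  qed
qed

text \<open>
  Smoothness of products of flat functions is obtained from closure: every member of this algebra is
  differentiable with derivative again in the algebra, so no formula for higher derivatives
  of a product or a composition is needed.
\<close>

inductive_set flat_algebra :: "(real \<Rightarrow> real) set" where
  affine: "(\<lambda>x. flat_exp p (m * x + c)) \<in> flat_algebra"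
| add: "f \<in> flat_algebra \<Longrightarrow> g \<in> flat_algebra \<Longrightarrow> (\<lambda>x. f x + g x) \<in> flat_algebra"
| mult: "f \<in> flat_algebra \<Longrightarrow> g \<in> flat_algebra \<Longrightarrow> (\<lambda>x. f x * g x) \<in> flat_algebra"

lemma flat_algebra_deriv:
  assumes "f \<in> flat_algebra"
  shows "(\<forall>x. (f has_real_derivative deriv f x) (at x)) \<and> deriv f \<in> flat_algebra"
  using assms
proof induction
  case (affine p m c)
  have "((\<lambda>x. flat_exp p (m * x + c)) has_real_derivative
      flat_exp (smult m ([:0, 0, 1:] * (p - pderiv p))) (m * x + c)) (at x)" for x
    by (rule DERIV_cong[OF DERIV_chain2[where f = "flat_exp p" and g = "\<lambda>x. m * x + c"
          and Db = m, OF flat_exp_has_derivative]])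
       (auto simp: flat_exp_def algebra_simps intro!: derivative_eq_intros)
  then show ?case
    by (metis (no_types, lifting) DERIV_imp_deriv ext flat_algebra.affine)
next
  case (add f g)
  have "((\<lambda>x. f x + g x) has_real_derivative deriv f x + deriv g x) (at x)" for x
    using add by (intro derivative_intros) auto
  moreover have "(\<lambda>x. deriv f x + deriv g x) \<in> flat_algebra"
    using add by (intro flat_algebra.add) auto
  ultimately show ?case
    by (metis (no_types, lifting) DERIV_imp_deriv ext)
next
  case (mult f g)
  have "((\<lambda>x. f x * g x) has_real_derivative deriv f x * g x + deriv g x * f x) (at x)" for x
    using mult by (intro DERIV_mult) auto
  moreover have "(\<lambda>x. deriv f x * g x + deriv g x * f x) \<in> flat_algebra"
    using mult by (intro flat_algebra.add flat_algebra.mult) auto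
  ultimately show ?case
    by (metis (no_types, lifting) DERIV_imp_deriv ext)
qed

lemma flat_algebra_smooth:
  assumes "f \<in> flat_algebra"
  shows "smooth_on UNIV f"
proof -
  have "(deriv ^^ n) f \<in> flat_algebra" for n
    by (induction n) (use assms flat_algebra_deriv in auto)
  then have "(deriv ^^ n) f differentiable_on UNIV" for n
    using flat_algebra_deriv
    by (auto simp: differentiable_on_def real_differentiable_def)
  then show ?thesis
    unfolding smooth_on_def by (intro exI[of _ UNIV]) auto
qed

text \<open>
  A bump on \<open>{a<..<b}\<close> whose flanks steepen as \<open>m\<close> grows.  One family serves two purposes: for fixed
  \<open>a, b\<close> and \<open>m\<close> tending to infinity it approximates an indicator function, and
  \<open>bump m (t - 1/m) (t + 1/m)\<close> is the rescaling of \<open>bump 1 (-1) 1\<close> that concentrates at \<open>t\<close>.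
\<close>

definition bump :: "real \<Rightarrow> real \<Rightarrow> real \<Rightarrow> real \<Rightarrow> real" where
  "bump m a b x = flat_exp 1 (m * (x - a)) * flat_exp 1 (m * (b - x))"

lemma bump_test_function:
  assumes "m > 0"
  shows "test_function (bump m a b)"
proof -
  \<comment> \<open>The bump with its arguments in the affine form that the generators of the algebra have.\<close>
  have "(\<lambda>x. flat_exp 1 (m * x + (- m * a)) * flat_exp 1 ((- m) * x + m * b)) \<in> flat_algebra"
    by (intro flat_algebra.intros)
  also have "(\<lambda>x. flat_exp 1 (m * x + (- m * a)) * flat_exp 1 ((- m) * x + m * b)) = bump m a b"
    by (auto simp: bump_def algebra_simps)
  finally have "smooth_on UNIV (bump m a b)"
    by (rule flat_algebra_smooth)
  moreover have "\<forall>t. t \<notin> {a..b} \<longrightarrow> bump m a b t = 0"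
    using assms by (auto simp: bump_def flat_exp_def zero_less_mult_iff)
  ultimately show ?thesis
    unfolding test_function_def using compact_Icc by blast
qed

lemma bump_bounds: "0 \<le> bump m a b x" "bump m a b x \<le> 1"
  by (auto simp: bump_def flat_exp_def intro!: mult_le_one)

lemma bump_eq_0: "m > 0 \<Longrightarrow> x \<notin> {a<..<b} \<Longrightarrow> bump m a b x = 0"
  by (auto simp: bump_def flat_exp_def zero_less_mult_iff)

lemma bump_tendsto_indicator:
  "(\<lambda>n. bump (real (Suc n)) a b x) \<longlonglongrightarrow> indicator {a<..<b} x"
proof (cases "x \<in> {a<..<b}")
  case True
  have "(\<lambda>n. exp (- (1 / (real (Suc n) * (x - a)))) * exp (- (1 / (real (Suc n) * (b - x)))))
      \<longlonglongrightarrow> exp (- (0 * (1 / (x - a)))) * exp (- (0 * (1 / (b - x))))"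
    unfolding divide_inverse inverse_mult_distrib mult_1_left
    by (intro tendsto_intros LIMSEQ_inverse_real_of_nat)
  then show ?thesis
    using True by (auto simp: bump_def flat_exp_def zero_less_mult_iff)
next
  case False
  then show ?thesis by (auto simp: bump_eq_0)
qed

lemma deriv_zero_outside_closed:
  fixes \<phi> :: "real \<Rightarrow> real"
  assumes "closed K" and zero: "\<And>x. x \<notin> K \<Longrightarrow> \<phi> x = 0" and "t \<notin> K"
  shows "deriv \<phi> t = 0"
proof -
  have "eventually (\<lambda>s. s \<in> - K) (nhds t)"
    using assms by (intro eventually_nhds_in_open) (auto simp: open_Compl)
  then have "eventually (\<lambda>s. \<phi> s = 0) (nhds t)"
    by eventually_elim (use zero in auto)
  then have "deriv \<phi> t = deriv (\<lambda>_. 0) t"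
    by (intro deriv_cong_ev) auto
  then show ?thesis by simp
qed

lemma test_function_deriv:
  assumes "test_function \<phi>"
  shows "(\<phi> has_real_derivative deriv \<phi> x) (at x)" "test_function (deriv \<phi>)"
proof -
  have d: "(deriv ^^ n) \<phi> differentiable_on UNIV" for n
    using assms unfolding test_function_def smooth_on_def by (metis top.extremum_uniqueI)
  show *: "(\<phi> has_real_derivative deriv \<phi> x) (at x)" for x
    using d[of 0] by (simp add: differentiable_on_def DERIV_deriv_iff_real_differentiable)
  obtain K where K: "compact K" "\<And>t. t \<notin> K \<Longrightarrow> \<phi> t = 0"
    using assms unfolding test_function_def by blast
  have "deriv \<phi> t = 0" if "t \<notin> K" for t
    using K that by (intro deriv_zero_outside_closed[of K \<phi>] compact_imp_closed)
  moreover have "(deriv ^^ n) (deriv \<phi>) differentiable_on UNIV" for n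
    using d[of "Suc n"] by (simp add: funpow_swap1)
  ultimately show "test_function (deriv \<phi>)"
    unfolding test_function_def smooth_on_def using K by blast
qed

lemma test_function_continuous:
  assumes "test_function \<phi>" shows "continuous_on A \<phi>"
  using DERIV_isCont[OF test_function_deriv(1)[OF assms]] continuous_at_imp_continuous_on by blast

section \<open>Locally integrable functions and uniqueness of weak derivatives\<close>

lemma truncation_tendsto:
  fixes f :: "real \<Rightarrow> real"
  shows "(\<lambda>n. indicator {- real n..real n} x *\<^sub>R f x) \<longlonglongrightarrow> f x"
proof (rule tendsto_eventually)
  obtain N where N: "\<bar>x\<bar> \<le> real N" using real_arch_simple by blast
  then show "\<forall>\<^sub>F n in sequentially. indicator {- real n..real n} x *\<^sub>R f x = f x"
    by (auto intro!: eventually_sequentiallyI[of N] simp: indicator_def)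
qed

lemma loc_integrable_measurable:
  assumes "loc_integrable f"
  shows "f \<in> borel_measurable borel"
proof -
  have "(\<lambda>n. indicator {- real n..real n} x *\<^sub>R f x) \<longlonglongrightarrow> f x" for x
    by (rule truncation_tendsto)
  then show ?thesis
  proof (rule borel_measurable_LIMSEQ_metric[rotated])
    show "(\<lambda>x. indicator {- real n..real n} x *\<^sub>R f x) \<in> borel_measurable borel" for n
      using assms unfolding loc_integrable_def set_integrable_def
      using borel_measurable_integrable by fastforce
  qed
qed

lemma loc_integrable_diff:
  "loc_integrable f \<Longrightarrow> loc_integrable g \<Longrightarrow> loc_integrable (\<lambda>x. f x - g x)"
  by (auto simp: loc_integrable_def intro: set_integral_diff)

lemma loc_integrable_continuous:
  "continuous_on UNIV f \<Longrightarrow> loc_integrable f"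
  unfolding loc_integrable_def
  by (auto intro: borel_integrable_atLeastAtMost' continuous_on_subset)

lemma integrable_mult_bounded_support:
  assumes f: "loc_integrable f" and m: "\<phi> \<in> borel_measurable borel"
    and B: "\<And>x. \<bar>\<phi> x\<bar> \<le> B" and supp: "\<And>x. x \<notin> {a..b} \<Longrightarrow> \<phi> x = 0"
  shows "integrable lborel (\<lambda>x. f x * \<phi> x)"
proof (rule Bochner_Integration.integrable_bound)
  show "integrable lborel (\<lambda>x. B * (indicator {a..b} x *\<^sub>R f x))"
    using f unfolding loc_integrable_def set_integrable_def
    by (intro Bochner_Integration.integrable_mult_right) auto
  show "(\<lambda>x. f x * \<phi> x) \<in> borel_measurable lborel"
    using loc_integrable_measurable[OF f] m by simp
  have "norm (f x * \<phi> x) \<le> norm (B * (indicator {a..b} x *\<^sub>R f x))" for x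
  proof (cases "x \<in> {a..b}")
    case True
    have "\<bar>f x\<bar> * \<bar>\<phi> x\<bar> \<le> \<bar>f x\<bar> * \<bar>B\<bar>"
      using B[of x] by (intro mult_left_mono) auto
    with True show ?thesis by (simp add: abs_mult mult.commute)
  qed (use supp in auto)
  then show "AE x in lborel. norm (f x * \<phi> x) \<le> norm (B * (indicator {a..b} x *\<^sub>R f x))"
    by simp
qed

lemma test_function_support:
  assumes "test_function \<phi>"
  obtains a b where "a < b" "\<And>x. x \<notin> {a..b} \<Longrightarrow> \<phi> x = 0"
proof -
  obtain K where "compact K" "\<And>t. t \<notin> K \<Longrightarrow> \<phi> t = 0"
    using assms unfolding test_function_def by blast
  moreover from \<open>compact K\<close> obtain B where "B > 0" "\<And>x. x \<in> K \<Longrightarrow> \<bar>x\<bar> \<le> B"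
    using compact_imp_bounded bounded_pos real_norm_def by metis
  ultimately have "\<phi> x = 0" if "x \<notin> {- B..B}" for x
    using that by (cases "x \<in> K") (force simp: abs_le_iff)+
  with \<open>B > 0\<close> show ?thesis
    by (intro that[of "- B" B]) simp_all
qed

lemma test_function_bounded:
  assumes "test_function \<phi>"
  obtains B where "\<And>x. \<bar>\<phi> x\<bar> \<le> B"
proof -
  obtain a b where ab: "a < b" "\<And>x. x \<notin> {a..b} \<Longrightarrow> \<phi> x = 0"
    using test_function_support[OF assms] by blast
  have "bounded (\<phi> ` {a..b})"
    by (intro compact_imp_bounded compact_continuous_image test_function_continuous assms) auto
  then obtain B where B: "B > 0" "\<And>x. x \<in> {a..b} \<Longrightarrow> \<bar>\<phi> x\<bar> \<le> B"
    unfolding bounded_pos by auto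
  have "\<bar>\<phi> x\<bar> \<le> B" for x
    using B ab(2)[of x] by (cases "x \<in> {a..b}") auto
  then show ?thesis by (rule that)
qed

lemma integrable_mult_test_function:
  assumes "loc_integrable f" "test_function \<phi>"
  shows "integrable lborel (\<lambda>x. f x * \<phi> x)"
proof -
  obtain a b where "\<And>x. x \<notin> {a..b} \<Longrightarrow> \<phi> x = 0"
    using test_function_support[OF assms(2)] by metis
  moreover obtain B where "\<And>x. \<bar>\<phi> x\<bar> \<le> B"
    using test_function_bounded[OF assms(2)] by metis
  ultimately show ?thesis
    using borel_measurable_continuous_onI[OF test_function_continuous[OF assms(2)]] assms(1)
    by (intro integrable_mult_bounded_support) auto
qed

text \<open>
  The sets over which \<open>f\<close> integrates to zero are closed under complements, since the
  total integral is a limit of integrals over intervals, and under countable disjoint unions.  Containing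
  the intervals, they contain all Borel sets.
\<close>

lemma AE_zero_if_interval_integrals_zero:
  fixes f :: "real \<Rightarrow> real"
  assumes int: "integrable lborel f" and Icc: "\<And>a b. (LINT x:{a..b}|lborel. f x) = 0"
  shows "AE x in lborel. f x = 0"
proof (rule sigma_finite_measure.density_zero[OF sigma_finite_lborel int])
  have set_int: "set_integrable lborel A f" if "A \<in> sets borel" for A
    using that int integrable_mult_indicator[of A lborel f] by (simp add: set_integrable_def)
  have total: "(LINT x|lborel. f x) = 0"
  proof -
    have "(\<lambda>n. LINT x:{- real n..real n}|lborel. f x) \<longlonglongrightarrow> (LINT x|lborel. f x)"
      unfolding set_lebesgue_integral_def
    proof (rule integral_dominated_convergence[where w = "\<lambda>x. norm (f x)"])
      show "AE x in lborel. (\<lambda>n. indicator {- real n..real n} x *\<^sub>R f x) \<longlonglongrightarrow> f x"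
        by (intro always_eventually allI truncation_tendsto)
    qed (use int in \<open>auto simp: indicator_def\<close>)
    with Icc show ?thesis
      by (simp add: LIMSEQ_const_iff)
  qed
  fix A :: "real set" assume "A \<in> sets lborel"
  then have "A \<in> sets borel" by simp
  then show "(LINT x:A|lborel. f x) = 0"
  proof (induction rule: borel_set_induct)
    case empty
    show ?case by (simp add: set_lebesgue_integral_def)
  next
    case (interval a b)
    show ?case by (rule Icc)
  next
    case (compl A)
    have "(LINT x:(A \<union> - A)|lborel. f x) = (LINT x:A|lborel. f x) + (LINT x:- A|lborel. f x)"
      using compl by (intro set_integral_Un set_int) auto
    then show ?case
      using compl total by (simp add: set_lebesgue_integral_def)
  next
    case (union A)
    have "(LINT x:(\<Union>i. A i)|lborel. f x) = (\<Sum>i. LINT x:A i|lborel. f x)"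
    proof (rule lebesgue_integral_countable_add)
      show "A i \<inter> A j = {}" if "i \<noteq> j" for i j
        using union.hyps(1) that by (auto simp: disjoint_family_on_def)
      show "set_integrable lborel (\<Union>i. A i) f"
        using union.hyps by (intro set_int) auto
    qed (use union.hyps in auto)
    then show ?case using union.IH by simp
  qed
qed

text \<open>
  Testing against bumps that increase to the indicator function of an interval shows, by dominated convergence,
  that \<open>f\<close> integrates to zero over every subinterval.
\<close>

lemma fundamental_lemma_calculus_of_variations:
  assumes f: "loc_integrable f"
    and zero: "\<And>\<phi>. test_function \<phi> \<Longrightarrow> (\<And>x. x \<notin> {c<..<d} \<Longrightarrow> \<phi> x = 0)
                  \<Longrightarrow> (LINT x|lborel. f x * \<phi> x) = 0"
  shows "AE x in lborel. x \<in> {c<..<d} \<longrightarrow> f x = 0"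
proof -
  have open_zero: "(LINT x|lborel. f x * indicator {a<..<b} x) = 0" if "c \<le> a" "b \<le> d" for a b
  proof -
    have "(\<lambda>n. LINT x|lborel. f x * bump (real (Suc n)) a b x)
        \<longlonglongrightarrow> (LINT x|lborel. f x * indicator {a<..<b} x)"
    proof (rule integral_dominated_convergence[where w = "\<lambda>x. \<bar>indicator {a..b} x *\<^sub>R f x\<bar>"])
      show "(\<lambda>x. f x * indicator {a<..<b} x) \<in> borel_measurable lborel"
        using loc_integrable_measurable[OF f] by simp
      show "(\<lambda>x. f x * bump (real (Suc n)) a b x) \<in> borel_measurable lborel" for n
        by (intro borel_measurable_integrable integrable_mult_test_function f bump_test_function) auto
      show "integrable lborel (\<lambda>x. \<bar>indicator {a..b} x *\<^sub>R f x\<bar>)"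
        using f unfolding loc_integrable_def set_integrable_def by (intro integrable_abs) auto
      show "AE x in lborel. (\<lambda>n. f x * bump (real (Suc n)) a b x) \<longlonglongrightarrow> f x * indicator {a<..<b} x"
        by (intro always_eventually allI tendsto_intros bump_tendsto_indicator)
      show "AE x in lborel. norm (f x * bump (real (Suc n)) a b x) \<le> \<bar>indicator {a..b} x *\<^sub>R f x\<bar>" for n
      proof (intro always_eventually allI)
        fix x
        show "norm (f x * bump (real (Suc n)) a b x) \<le> \<bar>indicator {a..b} x *\<^sub>R f x\<bar>"
          using bump_bounds[of "real (Suc n)" a b x] bump_eq_0[of "real (Suc n)" x a b]
          by (cases "x \<in> {a..b}") (auto simp: abs_mult intro: mult_left_le)
      qed
    qed
    moreover have "(LINT x|lborel. f x * bump (real (Suc n)) a b x) = 0" for n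
      using that by (intro zero bump_test_function bump_eq_0) auto
    ultimately show ?thesis by (simp add: LIMSEQ_const_iff)
  qed
  have "AE x in lborel. indicator {c<..<d} x *\<^sub>R f x = 0"
  proof (rule AE_zero_if_interval_integrals_zero)
    have "set_integrable lborel {c..d} f"
      using f by (simp add: loc_integrable_def)
    then have "set_integrable lborel {c<..<d} f"
      by (rule set_integrable_subset) auto
    then show "integrable lborel (\<lambda>x. indicator {c<..<d} x *\<^sub>R f x)"
      by (simp add: set_integrable_def)
    fix a b :: real
    \<comment> \<open>The bumps give open intervals only; the end points are a null set.\<close>
    have "AE x in lborel. x \<noteq> a \<and> x \<noteq> b"
      using AE_lborel_singleton[of a] AE_lborel_singleton[of b] by eventually_elim auto
    then have "(LINT x:{a..b}|lborel. indicator {c<..<d} x *\<^sub>R f x)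
        = (LINT x|lborel. f x * indicator {max a c<..<min b d} x)"
      unfolding set_lebesgue_integral_def
      using loc_integrable_measurable[OF f]
    proof (intro integral_cong_AE)
      show "AE x in lborel. indicator {a..b} x *\<^sub>R indicator {c<..<d} x *\<^sub>R f x
          = f x * indicator {max a c<..<min b d} x"
        using \<open>AE x in lborel. x \<noteq> a \<and> x \<noteq> b\<close> by eventually_elim (auto simp: indicator_def)
    qed auto
    also have "\<dots> = 0"
      by (rule open_zero) auto
    finally show "(LINT x:{a..b}|lborel. indicator {c<..<d} x *\<^sub>R f x) = 0" .
  qed
  then show ?thesis by eventually_elim (auto simp: indicator_def split: if_splits)
qed

lemma weak_deriv_unique:
  assumes "has_weak_deriv u v" "has_weak_deriv u v'"
  shows "AE x in lborel. v x = v' x"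
proof -
  have loc: "loc_integrable v" "loc_integrable v'"
    using assms by (auto simp: has_weak_deriv_def)
  have "(LINT x|lborel. (v x - v' x) * \<phi> x) = 0" if "test_function \<phi>" for \<phi>
  proof -
    have "(LINT x|lborel. (v x - v' x) * \<phi> x) = (LINT x|lborel. v x * \<phi> x - v' x * \<phi> x)"
      by (simp add: left_diff_distrib)
    also have "\<dots> = (LINT x|lborel. v x * \<phi> x) - (LINT x|lborel. v' x * \<phi> x)"
      using loc that by (intro Bochner_Integration.integral_diff integrable_mult_test_function)
    also have "\<dots> = 0"
    proof -
      have "- (LINT x|lborel. v x * \<phi> x) = - (LINT x|lborel. v' x * \<phi> x)"
        using assms that unfolding has_weak_deriv_def by simp
      then show ?thesis by simp
    qed
    finally show ?thesis .
  qed
  then have "AE x in lborel. x \<in> {- real n<..<real n} \<longrightarrow> v x - v' x = 0" for n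
    using loc by (intro fundamental_lemma_calculus_of_variations loc_integrable_diff)
  then have "AE x in lborel. \<forall>n. x \<in> {- real n<..<real n} \<longrightarrow> v x - v' x = 0"
    unfolding AE_all_countable by blast
  then show ?thesis
  proof eventually_elim
    case (elim x)
    obtain n where "\<bar>x\<bar> < real n" using reals_Archimedean2 by blast
    with elim show ?case by (auto simp: abs_less_iff)
  qed
qed

section \<open>Real analytic functions near critical points\<close>

lemma real_analytic_differentiable:
  assumes "real_analytic F"
  shows "(F has_real_derivative deriv F x) (at x)"
proof -
  obtain A where A: "(\<lambda>y. F (x + y)) has_fps_expansion A"
    using assms unfolding real_analytic_def by blast
  then have "(eval_fps A has_field_derivative eval_fps (fps_deriv A) 0) (at 0)"
    by (intro has_field_derivative_eval_fps) (auto simp: has_fps_expansion_def zero_ereal_def)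
  then have "((\<lambda>y. F (x + y)) has_field_derivative eval_fps (fps_deriv A) 0) (at 0)"
    by (rule DERIV_cong_ev[THEN iffD1, OF refl _ refl, rotated])
       (use A in \<open>simp add: has_fps_expansion_def\<close>)
  then have "(F has_field_derivative eval_fps (fps_deriv A) 0) (at x)"
    using DERIV_shift[of F _ 0 x] by (simp add: add.commute)
  then show ?thesis by (simp add: DERIV_imp_deriv)
qed

lemma real_analytic_deriv:
  assumes "real_analytic F"
  shows "real_analytic (deriv F)"
  unfolding real_analytic_def
proof
  fix x
  obtain A where A: "(\<lambda>y. F (x + y)) has_fps_expansion A"
    using assms unfolding real_analytic_def by blast
  have "deriv (\<lambda>y. F (x + y)) y = deriv F (x + y)" for y
    using DERIV_shift[of F _ y x] real_analytic_differentiable[OF assms, of "x + y"]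
    by (intro DERIV_imp_deriv) (simp add: add.commute)
  then have "deriv (\<lambda>y. F (x + y)) = (\<lambda>y. deriv F (x + y))" ..
  with has_fps_expansion_deriv[OF A] show "\<exists>A. (\<lambda>y. deriv F (x + y)) has_fps_expansion A"
    by auto
qed

lemma real_analytic_continuous:
  "real_analytic F \<Longrightarrow> continuous_on A F"
  using real_analytic_differentiable DERIV_isCont continuous_at_imp_continuous_on by blast

text \<open>
  The difference quotient of \<open>F'\<close> at \<open>c\<close> is bounded, hence \<open>F'\<close> is at most \<open>C * \<bar>y - c\<bar>\<close> near \<open>c\<close>, and the mean
  value inequality supplies the second factor \<open>\<bar>y - c\<bar>\<close>.
\<close>

lemma quadratic_bound_at_critical_point:
  assumes F: "real_analytic F" and crit: "deriv F c = 0"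
  obtains C d where "C \<ge> 0" "d > 0" "\<And>y. \<bar>y - c\<bar> < d \<Longrightarrow> \<bar>F y - F c\<bar> \<le> C * (y - c)\<^sup>2"
proof -
  have "(deriv F has_real_derivative deriv (deriv F) c) (at c)"
    using F by (intro real_analytic_differentiable real_analytic_deriv)
  then have "((\<lambda>y. deriv F y / (y - c)) \<longlongrightarrow> deriv (deriv F) c) (at c)"
    by (simp add: has_field_derivative_iff crit)
  then have "\<forall>\<^sub>F y in at c. dist (deriv F y / (y - c)) (deriv (deriv F) c) < 1"
    by (rule tendstoD) simp
  then obtain d where d: "d > 0"
      "\<And>y. y \<noteq> c \<Longrightarrow> dist y c < d \<Longrightarrow> dist (deriv F y / (y - c)) (deriv (deriv F) c) < 1"
    unfolding eventually_at by auto
  define C where "C = \<bar>deriv (deriv F) c\<bar> + 1"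
  have bound: "\<bar>deriv F y\<bar> \<le> C * \<bar>y - c\<bar>" if "\<bar>y - c\<bar> < d" for y
  proof (cases "y = c")
    case False
    then have "\<bar>deriv F y / (y - c)\<bar> \<le> C"
      using d(2)[of y] that unfolding dist_real_def C_def by linarith
    then show ?thesis
      using False by (simp add: abs_divide divide_le_eq)
  qed (simp add: crit)
  have "\<bar>F y - F c\<bar> \<le> C * (y - c)\<^sup>2" if y: "\<bar>y - c\<bar> < d" for y
  proof -
    have "norm (F y - F c) \<le> (C * \<bar>y - c\<bar>) * norm (y - c)"
    proof (rule field_differentiable_bound[where S = "cball c \<bar>y - c\<bar>"])
      show "(F has_field_derivative deriv F z) (at z within cball c \<bar>y - c\<bar>)" for z
        using real_analytic_differentiable[OF F] has_field_derivative_at_within by blast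
      show "norm (deriv F z) \<le> C * \<bar>y - c\<bar>" if "z \<in> cball c \<bar>y - c\<bar>" for z
      proof -
        have "\<bar>z - c\<bar> \<le> \<bar>y - c\<bar>" using that by (simp add: dist_real_def)
        moreover from this have "\<bar>deriv F z\<bar> \<le> C * \<bar>z - c\<bar>"
          using y by (intro bound) simp
        moreover have "C \<ge> 0" by (simp add: C_def)
        ultimately show ?thesis
          using mult_left_mono[of "\<bar>z - c\<bar>" "\<bar>y - c\<bar>" C] by simp
      qed
    qed (auto simp: dist_real_def)
    then show ?thesis
      by (simp add: power2_eq_square mult.assoc)
  qed
  then show ?thesis
    using d(1) by (intro that[of C d]) (auto simp: C_def)
qed


section \<open>The mean value inequality with countably many exceptional points\<close>

lemma countable_complement_dense:
  fixes a b :: real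
  assumes "countable S" "a < b"
  obtains x where "a < x" "x < b" "x \<notin> S"
proof -
  have "uncountable ({a<..<b} - S)"
    using assms by (intro uncountable_minus_countable) (auto simp: uncountable_open_interval)
  then have "{a<..<b} - S \<noteq> {}" using countable_empty by metis
  then obtain x where "x \<in> {a<..<b} - S" by blast
  then show ?thesis using that[of x] by simp
qed

text \<open>
  If the increment were too large, some slope \<open>M' > M\<close> would still be exceeded, and the tilted function
  \<open>g x = f x - f a - M' * (x - a)\<close> would rise from \<open>0\<close> to a positive value.  It takes only countably many
  values on \<open>S\<close>, so a level \<open>y\<close> in between is attained outside \<open>S\<close> only.  At the last point where \<open>g\<close> is at
  most \<open>y\<close> its derivative is negative by assumption, yet \<open>g\<close> exceeds \<open>y\<close> to the right of it.
\<close>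

lemma increment_le_countable_exceptions:
  fixes f :: "real \<Rightarrow> real"
  assumes "a \<le> b" and S: "countable S" and cont: "continuous_on {a..b} f"
    and deriv: "\<And>x. x \<in> {a<..<b} - S \<Longrightarrow> \<exists>D. (f has_real_derivative D) (at x) \<and> D \<le> M"
  shows "f b - f a \<le> M * (b - a)"
proof (rule ccontr)
  assume "\<not> ?thesis"
  then have big: "f b - f a > M * (b - a)" and "a < b"
    using \<open>a \<le> b\<close> by (auto simp: not_le less_le)
  have "M < (f b - f a) / (b - a)"
    using big \<open>a < b\<close> by (simp add: pos_less_divide_eq)
  then obtain M' where "M < M'" "M' < (f b - f a) / (b - a)"
    using dense by blast
  then have M': "M < M'" "M' * (b - a) < f b - f a"
    using \<open>a < b\<close> by (simp_all add: pos_less_divide_eq)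
  define g where "g x = f x - f a - M' * (x - a)" for x
  have contg: "continuous_on {a..b} g"
    unfolding g_def by (intro continuous_intros cont)
  have "g a = 0" "g b > 0"
    using M' by (auto simp: g_def)
  moreover have "countable (g ` S)"
    using S by simp
  ultimately obtain y where y: "0 < y" "y < g b" "y \<notin> g ` S"
    using countable_complement_dense by metis
  define Z where "Z = {x \<in> {a..b}. g x \<le> y}"
  have "compact Z"
    unfolding compact_eq_bounded_closed
  proof
    show "bounded Z" by (rule bounded_subset[of "{a..b}"]) (auto simp: Z_def)
    show "closed Z"
      unfolding Z_def by (intro continuous_on_closed_Collect_le contg continuous_on_const) simp
  qed
  moreover have "a \<in> Z" using \<open>a < b\<close> y \<open>g a = 0\<close> by (simp add: Z_def)
  ultimately obtain x where x: "x \<in> Z" "\<And>z. z \<in> Z \<Longrightarrow> z \<le> x"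
    using compact_attains_sup[of Z] by blast
  have above: "g z > y" if "z \<in> {x<..b}" for z
  proof (rule ccontr)
    assume "\<not> g z > y"
    then have "z \<in> Z" using that x(1) by (simp add: Z_def)
    from x(2)[OF this] that show False by simp
  qed
  have "x < b" using x(1) y by (cases "x = b") (auto simp: Z_def)
  have "g x = y"
  proof (rule antisym)
    show "g x \<le> y" using x by (simp add: Z_def)
    have "(g \<longlongrightarrow> g x) (at x within {x..b})"
    proof (rule tendsto_within_subset)
      show "(g \<longlongrightarrow> g x) (at x within {a..b})"
        using contg x(1) by (auto simp: Z_def continuous_on_def)
    qed (use x(1) in \<open>auto simp: Z_def\<close>)
    then have "(g \<longlongrightarrow> g x) (at_right x)"
      using \<open>x < b\<close> by (simp add: at_within_Icc_at_right)
    moreover have "\<forall>\<^sub>F z in at_right x. y \<le> g z"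
      using above \<open>x < b\<close> by (intro eventually_at_right[THEN iffD2]) (auto intro!: exI[of _ b] less_imp_le)
    moreover have "at_right x \<noteq> bot"
      by (rule trivial_limit_at_right_real)
    ultimately show "y \<le> g x"
      by (rule tendsto_lowerbound)
  qed
  then have "x \<in> {a<..<b} - S"
    using x(1) y \<open>g a = 0\<close> \<open>x < b\<close> by (auto simp: Z_def less_le)
  then obtain D where D: "(f has_real_derivative D) (at x)" "D \<le> M"
    using deriv by blast
  have "(g has_real_derivative D - M') (at x)"
    unfolding g_def by (auto intro!: derivative_eq_intros D)
  then obtain d where d: "d > 0" "\<And>h. h > 0 \<Longrightarrow> h < d \<Longrightarrow> g (x + h) < g x"
    using DERIV_neg_dec_right[of g "D - M'" x] D M' by auto
  define h where "h = min (d / 2) (b - x)"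
  have "h > 0" "h < d" "x + h \<le> b"
    using d \<open>x < b\<close> by (auto simp: h_def)
  with d(2)[of h] above[of "x + h"] \<open>g x = y\<close> show False by auto
qed

lemma abs_increment_le_countable_exceptions:
  fixes f :: "real \<Rightarrow> real"
  assumes "a \<le> b" and S: "countable S" and cont: "continuous_on {a..b} f"
    and deriv: "\<And>x. x \<in> {a<..<b} - S \<Longrightarrow> \<exists>D. (f has_real_derivative D) (at x) \<and> \<bar>D\<bar> \<le> M"
  shows "\<bar>f b - f a\<bar> \<le> M * (b - a)"
proof -
  have "f b - f a \<le> M * (b - a)"
    using deriv by (intro increment_le_countable_exceptions[OF assms(1-3)]) fastforce
  moreover have "(- f b) - (- f a) \<le> M * (b - a)"
  proof (rule increment_le_countable_exceptions[OF assms(1,2)])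
    show "\<exists>D. ((\<lambda>x. - f x) has_real_derivative D) (at x) \<and> D \<le> M" if "x \<in> {a<..<b} - S" for x
      using deriv[OF that] DERIV_minus by (metis abs_le_D2)
  qed (intro continuous_intros cont)
  ultimately show ?thesis by linarith
qed

section \<open>Kinks and second weak derivatives\<close>

lemma integral_deriv_test_function:
  assumes "test_function \<phi>"
  shows "(LINT x|lborel. deriv \<phi> x) = 0"
proof -
  obtain a b where ab: "a < b" "\<And>x. x \<notin> {a..b} \<Longrightarrow> \<phi> x = 0"
    using test_function_support[OF assms] by blast
  have "deriv \<phi> x = deriv \<phi> x * indicator {a - 1..b + 1} x" for x
    using deriv_zero_outside_closed[of "{a..b}" \<phi> x] ab(2)
    by (cases "x \<in> {a..b}") (auto simp: indicator_def)
  then have "(LINT x|lborel. deriv \<phi> x) = (LINT x|lborel. deriv \<phi> x * indicator {a - 1..b + 1} x)"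
    by presburger
  also have "(LINT x|lborel. deriv \<phi> x * indicator {a - 1..b + 1} x) = \<phi> (b + 1) - \<phi> (a - 1)"
  proof (rule integral_FTC_Icc_real)
    show "isCont (deriv \<phi>) x" for x
      using test_function_deriv(1)[OF test_function_deriv(2)[OF assms]] DERIV_isCont by blast
  qed (use ab test_function_deriv(1)[OF assms] in auto)
  finally show ?thesis using ab by simp
qed

text \<open>
  Integration by parts on each side of \<open>0\<close>: the second derivative of \<open>\<bar>y\<bar>\<close> is twice the point mass at \<open>0\<close>.
\<close>

lemma integral_abs_mult_second_deriv:
  assumes "test_function \<psi>" and supp: "\<And>x. x \<notin> {-1..1} \<Longrightarrow> \<psi> x = 0"
  shows "(LINT y|lborel. \<bar>y\<bar> * deriv (deriv \<psi>) y) = 2 * \<psi> 0"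
proof -
  note D = test_function_deriv[OF assms(1)]
  note D2 = test_function_deriv[OF D(2)]
  note D3 = test_function_deriv[OF D2(2)]
  have z1: "deriv \<psi> x = 0" if "x \<notin> {-1..1}" for x
    using deriv_zero_outside_closed[of "{-1..1}" \<psi> x] supp that by auto
  have z2: "deriv (deriv \<psi>) x = 0" if "x \<notin> {-1..1}" for x
    using deriv_zero_outside_closed[of "{-1..1}" "deriv \<psi>" x] z1 that by auto
  have cont: "isCont (deriv (deriv \<psi>)) y" for y
    using D3(1) DERIV_isCont by blast
  \<comment> \<open>The end points 2 and -2 lie away from the support, so that the boundary terms there vanish.\<close>
  have "has_bochner_integral lborel (\<lambda>y. (y * deriv (deriv \<psi>) y) * indicator {0..2} y)
      ((2 * deriv \<psi> 2 - \<psi> 2) - (0 * deriv \<psi> 0 - \<psi> 0))"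
    by (rule has_bochner_integral_FTC_Icc_real)
       (auto intro!: derivative_eq_intros D D2 continuous_intros cont)
  moreover have "has_bochner_integral lborel (\<lambda>y. (- y * deriv (deriv \<psi>) y) * indicator {-2..0} y)
      ((\<psi> 0 - 0 * deriv \<psi> 0) - (\<psi> (-2) - (-2) * deriv \<psi> (-2)))"
    by (rule has_bochner_integral_FTC_Icc_real)
       (auto intro!: derivative_eq_intros D D2 continuous_intros cont)
  ultimately have "has_bochner_integral lborel
      (\<lambda>y. (y * deriv (deriv \<psi>) y) * indicator {0..2} y + (- y * deriv (deriv \<psi>) y) * indicator {-2..0} y)
      (((2 * deriv \<psi> 2 - \<psi> 2) - (0 * deriv \<psi> 0 - \<psi> 0))
        + ((\<psi> 0 - 0 * deriv \<psi> 0) - (\<psi> (-2) - (-2) * deriv \<psi> (-2))))"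
    by (rule has_bochner_integral_add)
  moreover have "(y * deriv (deriv \<psi>) y) * indicator {0..2} y + (- y * deriv (deriv \<psi>) y) * indicator {-2..0} y
      = \<bar>y\<bar> * deriv (deriv \<psi>) y" for y
    using z2[of y] by (auto simp: indicator_def)
  ultimately show ?thesis
    using z1 supp by (simp add: has_bochner_integral_iff)
qed

lemma deriv_rescaled:
  fixes \<psi> :: "real \<Rightarrow> real"
  assumes "\<And>x. (\<psi> has_real_derivative deriv \<psi> x) (at x)"
  shows "deriv (\<lambda>x. \<psi> (m * (x - t))) = (\<lambda>x. m * deriv \<psi> (m * (x - t)))"
proof
  fix x
  have "((\<lambda>x. \<psi> (m * (x - t))) has_real_derivative deriv \<psi> (m * (x - t)) * m) (at x)"
    by (rule DERIV_chain2[where f = \<psi>, OF assms]) (auto intro!: derivative_eq_intros)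
  then show "deriv (\<lambda>x. \<psi> (m * (x - t))) x = m * deriv \<psi> (m * (x - t))"
    by (simp add: DERIV_imp_deriv mult.commute)
qed

lemma deriv_deriv_rescaled:
  assumes "test_function \<psi>"
  shows "deriv (deriv (\<lambda>x. \<psi> (m * (x - t)))) = (\<lambda>x. m\<^sup>2 * deriv (deriv \<psi>) (m * (x - t)))"
proof
  fix x
  note D2 = test_function_deriv[OF test_function_deriv(2)[OF assms]]
  have "deriv (\<lambda>x. \<psi> (m * (x - t))) = (\<lambda>x. m * deriv \<psi> (m * (x - t)))"
    by (intro deriv_rescaled test_function_deriv assms)
  moreover have "((\<lambda>x. m * deriv \<psi> (m * (x - t))) has_real_derivative
      m * (deriv (deriv \<psi>) (m * (x - t)) * m)) (at x)"
    by (intro DERIV_cmult DERIV_chain2[where f = "deriv \<psi>", OF D2(1)]) (auto intro!: derivative_eq_intros)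
  ultimately show "deriv (deriv (\<lambda>x. \<psi> (m * (x - t)))) x = m\<^sup>2 * deriv (deriv \<psi>) (m * (x - t))"
    by (simp add: DERIV_imp_deriv power2_eq_square mult_ac)
qed

text \<open>
  Test with \<open>\<phi> n x = \<psi> (m n * (x - t))\<close>, a fixed bump shrinking to the point \<open>t\<close>.  The right-hand side tends
  to zero because \<open>k\<close> is locally integrable.  On the left, subtracting the constant \<open>g t\<close> does not change
  the integral, and the substitution \<open>x = t + y / m n\<close> turns it into the integral of the difference quotient
  \<open>m n * (g (t + y / m n) - g t)\<close>, which tends to \<open>A * \<bar>y\<bar>\<close>, against \<open>\<psi>''\<close>.  The limit is \<open>2 * A * \<psi> 0\<close>.
\<close>

lemma loc_integrable_second_deriv_no_kink:
  assumes g: "continuous_on UNIV g" and k: "loc_integrable k"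
    and eq: "\<And>\<phi>. test_function \<phi> \<Longrightarrow>
      (LINT x|lborel. g x * deriv (deriv \<phi>) x) = (LINT x|lborel. k x * \<phi> x)"
    and slope: "((\<lambda>s. (g s - g t) / \<bar>s - t\<bar>) \<longlongrightarrow> A) (at t)"
  shows "A = 0"
proof -
  define \<psi> where "\<psi> = bump 1 (-1) 1"
  have \<psi>: "test_function \<psi>"
    unfolding \<psi>_def by (intro bump_test_function) simp
  have supp: "\<psi> x = 0" if "x \<notin> {-1<..<1}" for x
    using that unfolding \<psi>_def by (intro bump_eq_0) auto
  have supp2: "deriv (deriv \<psi>) x = 0" if "x \<notin> {-1..1}" for x
  proof (rule deriv_zero_outside_closed[of "{-1..1}" "deriv \<psi>"])
    show "deriv \<psi> y = 0" if "y \<notin> {-1..1}" for y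
      using that by (intro deriv_zero_outside_closed[of "{-1..1}" \<psi>] supp) auto
  qed (use that in auto)
  have \<psi>2: "test_function (deriv (deriv \<psi>))"
    by (intro test_function_deriv \<psi>)
  have "\<forall>\<^sub>F s in at t. dist ((g s - g t) / \<bar>s - t\<bar>) A < 1"
    using slope by (rule tendstoD) simp
  then obtain d0 where d0: "d0 > 0"
      "\<And>s. s \<noteq> t \<Longrightarrow> dist s t < d0 \<Longrightarrow> dist ((g s - g t) / \<bar>s - t\<bar>) A < 1"
    unfolding eventually_at by auto
  define B where "B = \<bar>A\<bar> + 1"
  \<comment> \<open>Halving makes the bound below available on the closed interval of radius d.\<close>
  define d where "d = d0 / 2"
  have d: "d > 0" using d0 by (simp add: d_def)
  have bound: "\<bar>g (t + h) - g t\<bar> \<le> B * \<bar>h\<bar>" if "\<bar>h\<bar> \<le> d" for h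
  proof (cases "h = 0")
    case False
    have "\<bar>(g (t + h) - g t) / \<bar>h\<bar> - A\<bar> < 1"
      using d0(2)[of "t + h"] False that d by (simp add: dist_real_def d_def)
    then have "\<bar>(g (t + h) - g t) / \<bar>h\<bar>\<bar> \<le> B"
      unfolding B_def by linarith
    then show ?thesis using False by (simp add: divide_le_eq)
  qed simp
  \<comment> \<open>The division by d keeps every rescaled bump inside the interval of radius d around t.\<close>
  define m where "m n = real (Suc n) / d" for n
  have m: "m n > 0" "1 / m n \<le> d" for n
    using d by (auto simp: m_def field_simps)
  have m_lim: "(\<lambda>n. y / m n) \<longlonglongrightarrow> 0" for y
  proof -
    have "(\<lambda>n. (y * d) * inverse (real (Suc n))) \<longlonglongrightarrow> (y * d) * 0"
      by (intro tendsto_intros LIMSEQ_inverse_real_of_nat)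
    then show ?thesis by (simp add: m_def field_simps)
  qed
  define \<phi> where "\<phi> n x = \<psi> (m n * (x - t))" for n x
  have \<phi>_bump: "\<phi> n = bump (m n) (t - 1 / m n) (t + 1 / m n)" for n
  proof
    fix x
    have "m n * (x - (t - 1 / m n)) = m n * (x - t) + 1" "m n * (t + 1 / m n - x) = 1 - m n * (x - t)"
      using m(1)[of n] by (simp_all add: field_simps)
    then show "\<phi> n x = bump (m n) (t - 1 / m n) (t + 1 / m n) x"
      unfolding \<phi>_def \<psi>_def bump_def by simp
  qed
  have \<phi>: "test_function (\<phi> n)" for n
    unfolding \<phi>_bump by (intro bump_test_function m)

  have "(\<lambda>n. LINT x|lborel. k x * \<phi> n x) \<longlonglongrightarrow> (LINT x|(lborel :: real measure). (0 :: real))"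
  proof (rule integral_dominated_convergence[where w = "\<lambda>x. \<bar>indicator {t - d..t + d} x *\<^sub>R k x\<bar>"])
    show "(\<lambda>x. k x * \<phi> n x) \<in> borel_measurable lborel" for n
      by (intro borel_measurable_integrable integrable_mult_test_function k \<phi>)
    show "integrable lborel (\<lambda>x. \<bar>indicator {t - d..t + d} x *\<^sub>R k x\<bar>)"
      using k unfolding loc_integrable_def set_integrable_def by (intro integrable_abs) auto
    have "(\<lambda>n. k x * \<phi> n x) \<longlonglongrightarrow> 0" if "x \<noteq> t" for x
    proof (rule tendsto_eventually)
      have "\<forall>\<^sub>F n in sequentially. norm (1 / m n) < \<bar>x - t\<bar>"
        using order_tendstoD(2)[OF tendsto_norm[OF m_lim[of 1]], of "\<bar>x - t\<bar>"] that by simp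
      then show "\<forall>\<^sub>F n in sequentially. k x * \<phi> n x = 0"
      proof eventually_elim
        case (elim n)
        then have "x \<notin> {t - 1 / m n<..<t + 1 / m n}"
          using m(1)[of n] by (auto simp: abs_if split: if_splits)
        then show ?case
          unfolding \<phi>_bump using m(1)[of n] by (simp add: bump_eq_0)
      qed
    qed
    then show "AE x in lborel. (\<lambda>n. k x * \<phi> n x) \<longlonglongrightarrow> 0"
      using AE_lborel_singleton[of t] by (auto elim: eventually_mono)
    show "AE x in lborel. norm (k x * \<phi> n x) \<le> \<bar>indicator {t - d..t + d} x *\<^sub>R k x\<bar>" for n
    proof (intro always_eventually allI)
      fix x
      show "norm (k x * \<phi> n x) \<le> \<bar>indicator {t - d..t + d} x *\<^sub>R k x\<bar>"
      proof (cases "x \<in> {t - d..t + d}")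
        case True
        then show ?thesis
          using bump_bounds[of "m n" "t - 1 / m n" "t + 1 / m n" x]
          by (auto simp: abs_mult \<phi>_bump intro: mult_left_le)
      next
        case False
        then have "\<phi> n x = 0"
          unfolding \<phi>_bump using m[of n] by (intro bump_eq_0) auto
        then show ?thesis by simp
      qed
    qed
  qed simp
  then have rhs: "(\<lambda>n. LINT x|lborel. k x * \<phi> n x) \<longlonglongrightarrow> 0" by simp

  have lhs_eq: "(LINT x|lborel. k x * \<phi> n x)
      = (LINT y|lborel. (m n * (g (t + y / m n) - g t)) * deriv (deriv \<psi>) y)" for n
  proof -
    have \<phi>2: "test_function (deriv (deriv (\<phi> n)))"
      by (intro test_function_deriv \<phi>)
    have gi: "integrable lborel (\<lambda>x. g x * deriv (deriv (\<phi> n)) x)"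
      by (intro integrable_mult_test_function loc_integrable_continuous g \<phi>2)
    have ci: "integrable lborel (\<lambda>x. g t * deriv (deriv (\<phi> n)) x)"
      by (intro integrable_mult_test_function loc_integrable_continuous \<phi>2) auto
    have "(LINT x|lborel. k x * \<phi> n x) = (LINT x|lborel. g x * deriv (deriv (\<phi> n)) x)"
      using eq[OF \<phi>] by simp
    also have "\<dots> = (LINT x|lborel. g x * deriv (deriv (\<phi> n)) x) - (LINT x|lborel. g t * deriv (deriv (\<phi> n)) x)"
      using integral_deriv_test_function[OF test_function_deriv(2)[OF \<phi>]] by simp
    also have "\<dots> = (LINT x|lborel. (g x - g t) * deriv (deriv (\<phi> n)) x)"
      using gi ci by (simp add: left_diff_distrib)
    also have "\<dots> = (LINT x|lborel. (g x - g t) * ((m n)\<^sup>2 * deriv (deriv \<psi>) (m n * (x - t))))"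
      using deriv_deriv_rescaled[OF \<psi>, of "m n" t] unfolding \<phi>_def by simp
    also have "\<dots> = (1 / m n) * (LINT y|lborel. (g (t + y / m n) - g t) * ((m n)\<^sup>2 * deriv (deriv \<psi>) y))"
      using m(1)[of n] by (subst lborel_integral_real_affine[where c = "1 / m n" and t = t]) auto
    also have "\<dots> = (LINT y|lborel. (1 / m n) * ((g (t + y / m n) - g t) * ((m n)\<^sup>2 * deriv (deriv \<psi>) y)))"
      by simp
    also have "\<dots> = (LINT y|lborel. (m n * (g (t + y / m n) - g t)) * deriv (deriv \<psi>) y)"
      using m(1)[of n] by (intro Bochner_Integration.integral_cong) (auto simp: power2_eq_square field_simps)
    finally show ?thesis .
  qed

  have "(\<lambda>n. LINT y|lborel. (m n * (g (t + y / m n) - g t)) * deriv (deriv \<psi>) y)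
      \<longlonglongrightarrow> (LINT y|lborel. (A * \<bar>y\<bar>) * deriv (deriv \<psi>) y)"
  proof (rule integral_dominated_convergence[where w = "\<lambda>y. \<bar>(B * \<bar>y\<bar>) * deriv (deriv \<psi>) y\<bar>"])
    show "(\<lambda>y. (A * \<bar>y\<bar>) * deriv (deriv \<psi>) y) \<in> borel_measurable lborel"
      by (intro borel_measurable_integrable integrable_mult_test_function \<psi>2
          loc_integrable_continuous continuous_intros)
    have "continuous_on UNIV (\<lambda>y. m n * (g (t + y / m n) - g t))" for n
      using m(1)[of n] by (intro continuous_intros continuous_on_compose2[OF g]) auto
    then show "(\<lambda>y. (m n * (g (t + y / m n) - g t)) * deriv (deriv \<psi>) y) \<in> borel_measurable lborel" for n
      by (intro borel_measurable_integrable integrable_mult_test_function \<psi>2 loc_integrable_continuous)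
    show "integrable lborel (\<lambda>y. \<bar>(B * \<bar>y\<bar>) * deriv (deriv \<psi>) y\<bar>)"
      by (intro integrable_abs integrable_mult_test_function \<psi>2
          loc_integrable_continuous continuous_intros)
    have "(\<lambda>n. m n * (g (t + y / m n) - g t)) \<longlonglongrightarrow> A * \<bar>y\<bar>" for y
    proof (cases "y = 0")
      case False
      have "filterlim (\<lambda>n. t + y / m n) (at t) sequentially"
        using tendsto_add[OF tendsto_const[of t] m_lim[of y]] False m(1)
        by (auto simp: filterlim_at less_imp_neq intro!: always_eventually) (metis less_irrefl)
      then have "(\<lambda>n. (g (t + y / m n) - g t) / \<bar>(t + y / m n) - t\<bar>) \<longlonglongrightarrow> A"
        by (rule filterlim_compose[OF slope])
      then have "(\<lambda>n. (g (t + y / m n) - g t) / \<bar>(t + y / m n) - t\<bar> * \<bar>y\<bar>) \<longlonglongrightarrow> A * \<bar>y\<bar>"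
        by (intro tendsto_intros)
      moreover have "(g (t + y / m n) - g t) / \<bar>(t + y / m n) - t\<bar> * \<bar>y\<bar> = m n * (g (t + y / m n) - g t)" for n
        using m(1)[of n] False by (simp add: abs_divide)
      ultimately show ?thesis by simp
    qed simp
    then show "AE y in lborel. (\<lambda>n. (m n * (g (t + y / m n) - g t)) * deriv (deriv \<psi>) y)
        \<longlonglongrightarrow> (A * \<bar>y\<bar>) * deriv (deriv \<psi>) y"
      by (intro always_eventually allI tendsto_mult_right)
    show "AE y in lborel. norm ((m n * (g (t + y / m n) - g t)) * deriv (deriv \<psi>) y)
        \<le> \<bar>(B * \<bar>y\<bar>) * deriv (deriv \<psi>) y\<bar>" for n
    proof (intro always_eventually allI)
      fix y
      show "norm ((m n * (g (t + y / m n) - g t)) * deriv (deriv \<psi>) y) \<le> \<bar>(B * \<bar>y\<bar>) * deriv (deriv \<psi>) y\<bar>"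
      proof (cases "y \<in> {-1..1}")
        case True
        then have "\<bar>y\<bar> / m n \<le> 1 / m n"
          using m(1)[of n] by (intro divide_right_mono) auto
        then have "\<bar>y / m n\<bar> \<le> d"
          using m[of n] by simp
        from bound[OF this] have "m n * \<bar>g (t + y / m n) - g t\<bar> \<le> m n * (B * \<bar>y / m n\<bar>)"
          using m(1)[of n] by (intro mult_left_mono) auto
        also have "\<dots> = B * \<bar>y\<bar>"
          using m(1)[of n] by simp
        finally have "\<bar>m n * (g (t + y / m n) - g t)\<bar> \<le> \<bar>B * \<bar>y\<bar>\<bar>"
          using m(1)[of n] by (simp add: abs_mult B_def)
        then show ?thesis
          unfolding real_norm_def abs_mult[of _ "deriv (deriv \<psi>) y"] by (intro mult_right_mono) auto
      qed (simp add: supp2)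
    qed
  qed
  also have "(LINT y|lborel. (A * \<bar>y\<bar>) * deriv (deriv \<psi>) y) = A * (2 * \<psi> 0)"
  proof -
    have "(LINT y|lborel. \<bar>y\<bar> * deriv (deriv \<psi>) y) = 2 * \<psi> 0"
      by (intro integral_abs_mult_second_deriv \<psi> supp) auto
    then show ?thesis by (simp add: mult.assoc)
  qed
  finally have "(\<lambda>n. LINT x|lborel. k x * \<phi> n x) \<longlonglongrightarrow> A * (2 * \<psi> 0)"
    unfolding lhs_eq .
  with rhs have "A * (2 * \<psi> 0) = 0"
    using LIMSEQ_unique by fastforce
  moreover have "\<psi> 0 > 0"
    by (simp add: \<psi>_def bump_def flat_exp_def)
  ultimately show ?thesis by simp
qed

section \<open>Waves near a peak\<close>

text \<open>
  Inserting \<open>\<phi>'\<close> as a test function into the definition of \<open>w\<close> removes \<open>w\<close> from the equation.  Square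
  integrability is known for the weak derivative in \<open>H1_loc\<close> only; it passes to \<open>v\<close> by
  uniqueness of weak derivatives, and without it the integral in the equation could not be split.
\<close>

lemma TWS_second_weak_deriv:
  assumes F: "real_analytic F" and u: "TWS F u"
  obtains v where "has_weak_deriv u v" "loc_integrable (\<lambda>x. (v x)\<^sup>2 - 2 * deriv F (u x))"
    "\<forall>\<phi>. test_function \<phi> \<longrightarrow> (LINT x|lborel. (u x)\<^sup>2 * deriv (deriv \<phi>) x)
        = (LINT x|lborel. ((v x)\<^sup>2 - 2 * deriv F (u x)) * \<phi> x)"
proof -
  from u obtain v w where v: "has_weak_deriv u v" and w: "has_weak_deriv (\<lambda>t. (u t)\<^sup>2) w"
    and eq: "\<And>\<phi>. test_function \<phi> \<Longrightarrow>
          (LINT t|lborel. w t * deriv \<phi> t + (v t)\<^sup>2 * \<phi> t - 2 * deriv F (u t) * \<phi> t) = 0"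
    unfolding TWS_def by blast
  from u obtain v' where v': "has_weak_deriv u v'" "loc_integrable (\<lambda>t. (v' t)\<^sup>2)"
    unfolding TWS_def H1_loc_def by blast
  have cont: "continuous_on UNIV u"
    using u by (simp add: TWS_def H1_loc_def)
  have loc: "loc_integrable v" "loc_integrable w" "loc_integrable v'"
    using v w v' by (auto simp: has_weak_deriv_def)
  have meas: "v \<in> borel_measurable borel" "v' \<in> borel_measurable borel"
    using loc loc_integrable_measurable by auto
  have v2: "loc_integrable (\<lambda>t. (v t)\<^sup>2)"
    unfolding loc_integrable_def set_integrable_def
  proof (intro allI)
    fix a b
    have "integrable lborel (\<lambda>x. indicator {a..b} x *\<^sub>R (v' x)\<^sup>2)"
      using v'(2) by (auto simp: loc_integrable_def set_integrable_def)
    moreover have "AE x in lborel. indicator {a..b} x *\<^sub>R (v' x)\<^sup>2 = indicator {a..b} x *\<^sub>R (v x)\<^sup>2"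
      using weak_deriv_unique[OF v v'(1)] by eventually_elim simp
    ultimately show "integrable lborel (\<lambda>x. indicator {a..b} x *\<^sub>R (v x)\<^sup>2)"
      by (subst (asm) integrable_cong_AE) (use meas in auto)
  qed
  have F': "loc_integrable (\<lambda>t. 2 * deriv F (u t))"
    by (intro loc_integrable_continuous continuous_intros continuous_on_compose2[OF _ cont]
        real_analytic_continuous[OF real_analytic_deriv[OF F]]) auto
  show ?thesis
  proof (rule that[OF v], goal_cases)
    case 1
    show ?case by (intro loc_integrable_diff v2 F')
  next
    case 2
    show ?case
    proof (intro allI impI)
      fix \<phi> assume \<phi>: "test_function \<phi>"
      note \<phi>' = test_function_deriv(2)[OF \<phi>]
      have i1: "integrable lborel (\<lambda>t. w t * deriv \<phi> t)"
        by (intro integrable_mult_test_function loc \<phi>')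
      have i2: "integrable lborel (\<lambda>t. ((v t)\<^sup>2 - 2 * deriv F (u t)) * \<phi> t)"
        by (intro integrable_mult_test_function loc_integrable_diff v2 F' \<phi>)
      have "(LINT t|lborel. w t * deriv \<phi> t + (v t)\<^sup>2 * \<phi> t - 2 * deriv F (u t) * \<phi> t)
          = (LINT t|lborel. w t * deriv \<phi> t + ((v t)\<^sup>2 - 2 * deriv F (u t)) * \<phi> t)"
        by (intro Bochner_Integration.integral_cong) (auto simp: algebra_simps)
      also have "\<dots> = (LINT t|lborel. w t * deriv \<phi> t)
          + (LINT t|lborel. ((v t)\<^sup>2 - 2 * deriv F (u t)) * \<phi> t)"
        by (intro Bochner_Integration.integral_add i1 i2)
      finally have "(LINT t|lborel. ((v t)\<^sup>2 - 2 * deriv F (u t)) * \<phi> t) = - (LINT t|lborel. w t * deriv \<phi> t)"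
        using eq[OF \<phi>] by simp
      also have "\<dots> = (LINT x|lborel. (u x)\<^sup>2 * deriv (deriv \<phi>) x)"
        using w \<phi>' by (simp add: has_weak_deriv_def)
      finally show "(LINT x|lborel. (u x)\<^sup>2 * deriv (deriv \<phi>) x)
          = (LINT x|lborel. ((v x)\<^sup>2 - 2 * deriv F (u x)) * \<phi> x)" ..
    qed
  qed
qed

text \<open>
  The two alternatives for a singular wave agree here: a wave that is classical everywhere has an empty exceptional set.
\<close>

lemma singular_TWS_energy:
  assumes "singular_TWS F u"
  shows "\<exists>h S. countable S \<and> (\<forall>x. x \<notin> S \<longrightarrow> (u has_real_derivative deriv u x) (at x)
    \<and> u x * (deriv u x)\<^sup>2 / 2 + F (u x) = h)"
proof -
  from assms obtain h S where "countable S" "classical_energy_solution F h (- S) u"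
    unfolding singular_TWS_def by (metis Compl_empty_eq countable_empty)
  then show ?thesis
    by (intro exI[of _ h] exI[of _ S])
       (auto simp: classical_energy_solution_def energy_def DERIV_deriv_iff_real_differentiable)
qed

text \<open>
  L'Hospital's rule turns the one-sided limits of \<open>u'\<close> into one-sided slopes at \<open>t\<close>.  With \<open>\<bar>s - t\<bar>\<close> in
  the denominator the opposite signs merge into a single two-sided limit.
\<close>

lemma peak_slopes:
  assumes peak: "is_peak u t" and cont: "isCont u t"
  obtains a where "a \<noteq> 0" "(deriv u \<longlongrightarrow> a) (at_right t)"
    "((\<lambda>s. (u s - u t) / \<bar>s - t\<bar>) \<longlongrightarrow> a) (at t)"
proof -
  from peak obtain a where a: "a \<noteq> 0" "(deriv u \<longlongrightarrow> a) (at_right t)" "(deriv u \<longlongrightarrow> - a) (at_left t)"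
    and diff: "\<forall>\<^sub>F s in at t. u differentiable (at s)"
    unfolding is_peak_def by blast
  have D: "\<forall>\<^sub>F s in at t. (u has_real_derivative deriv u s) (at s)"
    using diff by eventually_elim (simp add: DERIV_deriv_iff_real_differentiable)
  then have D1: "\<forall>\<^sub>F s in at t. ((\<lambda>s. u s - u t) has_real_derivative deriv u s) (at s)"
    by eventually_elim (auto intro!: derivative_eq_intros)
  have D2: "((\<lambda>s. s - t) has_real_derivative 1) (at s)" for s
    by (auto intro!: derivative_eq_intros)
  have num: "((\<lambda>s. u s - u t) \<longlongrightarrow> 0) (at t)"
    using cont by (simp add: isCont_def LIM_zero)
  have den: "((\<lambda>s. s - t) \<longlongrightarrow> 0) (at t)"
    by (rule LIM_zero) simp
  note sides = num[unfolded filterlim_at_split] den[unfolded filterlim_at_split]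
    D1[unfolded eventually_at_split]
  have "((\<lambda>s. (u s - u t) / (s - t)) \<longlongrightarrow> a) (at_right t)"
    by (rule lhopital_right[where f' = "deriv u" and g' = "\<lambda>_. 1"])
       (use sides D2 a in \<open>auto simp: eventually_at_filter\<close>)
  then have right: "((\<lambda>s. (u s - u t) / \<bar>s - t\<bar>) \<longlongrightarrow> a) (at_right t)"
    by (rule Lim_transform_eventually) (auto simp: eventually_at_filter)
  have "((\<lambda>s. (u s - u t) / (s - t)) \<longlongrightarrow> - a) (at_left t)"
    by (rule lhopital_left[where f' = "deriv u" and g' = "\<lambda>_. 1"])
       (use sides D2 a in \<open>auto simp: eventually_at_filter\<close>)
  from tendsto_minus[OF this] have "((\<lambda>s. - ((u s - u t) / (s - t))) \<longlongrightarrow> a) (at_left t)"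
    by simp
  then have "((\<lambda>s. (u s - u t) / \<bar>s - t\<bar>) \<longlongrightarrow> a) (at_left t)"
    by (rule Lim_transform_eventually) (auto simp: eventually_at_filter abs_of_neg minus_divide_right)
  with right have "((\<lambda>s. (u s - u t) / \<bar>s - t\<bar>) \<longlongrightarrow> a) (at t)"
    by (simp add: filterlim_at_split)
  with a show ?thesis using that by blast
qed

text \<open>
  The kink of \<open>u\<close> with slope \<open>a\<close> is a kink of \<open>u\<^sup>2\<close> with slope \<open>2 * a * u t\<close>, which must be zero.
\<close>

lemma TWS_zero_at_peak:
  assumes F: "real_analytic F" and u: "TWS F u" and peak: "is_peak u t"
  shows "u t = 0"
proof -
  have cont: "continuous_on UNIV u"
    using u by (simp add: TWS_def H1_loc_def)
  then have "isCont u t" by (simp add: continuous_on_eq_continuous_at)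
  obtain a where a: "a \<noteq> 0" "((\<lambda>s. (u s - u t) / \<bar>s - t\<bar>) \<longlongrightarrow> a) (at t)"
    by (rule peak_slopes[OF peak \<open>isCont u t\<close>])
  obtain v where "has_weak_deriv u v" and v: "loc_integrable (\<lambda>x. (v x)\<^sup>2 - 2 * deriv F (u x))"
    "\<forall>\<phi>. test_function \<phi> \<longrightarrow> (LINT x|lborel. (u x)\<^sup>2 * deriv (deriv \<phi>) x)
        = (LINT x|lborel. ((v x)\<^sup>2 - 2 * deriv F (u x)) * \<phi> x)"
    by (rule TWS_second_weak_deriv[OF F u])
  have "((\<lambda>s. (u s - u t) / \<bar>s - t\<bar> * (u s + u t)) \<longlongrightarrow> a * (u t + u t)) (at t)"
    using a(2) \<open>isCont u t\<close> by (intro tendsto_intros) (simp_all add: isCont_def)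
  moreover have "(u s - u t) / \<bar>s - t\<bar> * (u s + u t) = ((u s)\<^sup>2 - (u t)\<^sup>2) / \<bar>s - t\<bar>" for s
    by (simp add: power2_eq_square square_diff_square_factored mult.commute)
  ultimately have "((\<lambda>s. ((u s)\<^sup>2 - (u t)\<^sup>2) / \<bar>s - t\<bar>) \<longlongrightarrow> a * (u t + u t)) (at t)"
    by (simp only:)
  with v have "a * (u t + u t) = 0"
    by (intro loc_integrable_second_deriv_no_kink[of "\<lambda>s. (u s)\<^sup>2"]) (auto intro!: continuous_intros cont)
  with a(1) show ?thesis by simp
qed

text \<open>
  The limit at \<open>t\<close> is taken through points on the right of \<open>t\<close> that are not exceptional; they accumulate
  at \<open>t\<close> because only countably many points are exceptional.  As \<open>u\<close> tends to \<open>0\<close> and \<open>u'\<close> to \<open>a\<close>, the identity gives \<open>h = F 0\<close>, and then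
  \<open>(F u - F 0) / u = - u'\<^sup>2 / 2\<close> tends both to \<open>F' 0\<close> and to \<open>- a\<^sup>2 / 2\<close>.
\<close>

lemma peak_imp_deriv_neg:
  assumes F: "real_analytic F" and u: "singular_TWS F u" and peak: "is_peak u t"
  shows "deriv F 0 < 0"
proof -
  have TWS: "TWS F u" using u by (simp add: singular_TWS_def)
  then have isCont: "isCont u t"
    by (simp add: TWS_def H1_loc_def continuous_on_eq_continuous_at)
  have zero: "u t = 0" by (rule TWS_zero_at_peak[OF F TWS peak])
  obtain a where a: "a \<noteq> 0" "(deriv u \<longlongrightarrow> a) (at_right t)"
      "((\<lambda>s. (u s - u t) / \<bar>s - t\<bar>) \<longlongrightarrow> a) (at t)"
    by (rule peak_slopes[OF peak isCont])
  from singular_TWS_energy[OF u] obtain h S where S: "countable S"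
      and off_S: "\<forall>x. x \<notin> S \<longrightarrow> (u has_real_derivative deriv u x) (at x)
        \<and> u x * (deriv u x)\<^sup>2 / 2 + F (u x) = h"
    by (elim exE conjE) (rule that)
  have energy: "u x * (deriv u x)\<^sup>2 / 2 + F (u x) = h" if "x \<notin> S" for x
    using off_S that by simp
  define G where "G = at t within ({t<..} - S)"
  have "G \<noteq> bot"
    unfolding G_def trivial_limit_within islimpt_approachable not_not
  proof (intro allI impI)
    fix e :: real assume "e > 0"
    then obtain x where "t < x" "x < t + e" "x \<notin> S"
      using countable_complement_dense[OF S, of t "t + e"] by auto
    then show "\<exists>x\<in>{t<..} - S. x \<noteq> t \<and> dist x t < e"
      by (intro bexI[of _ x]) (auto simp: dist_real_def)
  qed
  have u_lim: "(u \<longlongrightarrow> 0) G"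
    using isCont zero unfolding G_def isCont_def by (metis tendsto_within_subset subset_UNIV)
  have u'_lim: "(deriv u \<longlongrightarrow> a) G"
    using a(2) unfolding G_def by (rule tendsto_within_subset) auto
  have q_lim: "((\<lambda>s. (u s - u t) / \<bar>s - t\<bar>) \<longlongrightarrow> a) G"
    using a(3) unfolding G_def by (rule tendsto_within_subset) auto
  have notS: "\<forall>\<^sub>F s in G. s \<notin> S"
    by (auto simp: G_def eventually_at_filter)
  have F_lim: "((\<lambda>s. F (u s)) \<longlongrightarrow> F 0) G"
    using u_lim DERIV_isCont[OF real_analytic_differentiable[OF F]]
    by (rule isCont_tendsto_compose[rotated])
  have "((\<lambda>s. u s * (deriv u s)\<^sup>2 / 2 + F (u s)) \<longlongrightarrow> 0 * a\<^sup>2 / 2 + F 0) G"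
    by (intro tendsto_intros u_lim u'_lim F_lim) simp
  moreover have "((\<lambda>s. u s * (deriv u s)\<^sup>2 / 2 + F (u s)) \<longlongrightarrow> h) G"
    using notS by (intro tendsto_eventually) (auto elim!: eventually_mono simp: energy)
  ultimately have h: "h = F 0"
    using tendsto_unique[OF \<open>G \<noteq> bot\<close>] by fastforce
  have nz: "\<forall>\<^sub>F s in G. u s \<noteq> 0"
    using tendsto_imp_eventually_ne[OF q_lim a(1)] by eventually_elim (use zero in auto)
  have "((\<lambda>y. (F y - F 0) / (y - 0)) \<longlongrightarrow> deriv F 0) (at 0)"
    using real_analytic_differentiable[OF F, of 0] by (simp add: has_field_derivative_iff)
  moreover have "filterlim u (at 0) G"
    using u_lim nz by (simp add: filterlim_at)
  ultimately have "((\<lambda>s. (F (u s) - F 0) / (u s - 0)) \<longlongrightarrow> deriv F 0) G"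
    by (rule filterlim_compose)
  moreover have "((\<lambda>s. (F (u s) - F 0) / (u s - 0)) \<longlongrightarrow> - (a\<^sup>2 / 2)) G"
  proof (rule Lim_transform_eventually)
    show "((\<lambda>s. - ((deriv u s)\<^sup>2 / 2)) \<longlongrightarrow> - (a\<^sup>2 / 2)) G"
      by (intro tendsto_intros u'_lim) simp
    show "\<forall>\<^sub>F s in G. - ((deriv u s)\<^sup>2 / 2) = (F (u s) - F 0) / (u s - 0)"
      using notS nz
    proof eventually_elim
      case (elim s)
      then have "F (u s) - F 0 = - (u s * (deriv u s)\<^sup>2 / 2)"
        using energy[of s] h by linarith
      with elim show ?case by simp
    qed
  qed
  ultimately have "deriv F 0 = - (a\<^sup>2 / 2)"
    by (rule tendsto_unique[OF \<open>G \<noteq> bot\<close>])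
  with a(1) show ?thesis by simp
qed


section \<open>Waves that are constant on an interval\<close>

lemma AE_lborel_ex_in_interval:
  fixes a b :: real
  assumes "AE x in lborel. P x" "a < b"
  obtains x where "x \<in> {a<..<b}" "P x"
proof -
  have "\<not> (AE x in lborel. x \<notin> {a<..<b})"
  proof
    assume "AE x in lborel. x \<notin> {a<..<b}"
    then have "emeasure lborel {x \<in> space lborel. \<not> x \<notin> {a<..<b}} = 0"
      by (subst (asm) AE_iff_measurable[OF _ refl]) auto
    moreover have "{x \<in> space lborel. \<not> x \<notin> {a<..<b}} = {a<..<b}" by auto
    ultimately show False using \<open>a < b\<close> by simp
  qed
  with assms(1) show ?thesis
    using that by (metis (mono_tags, lifting) eventually_mono)
qed

text \<open>
  Where \<open>u\<close> is constant, \<open>v\<close> vanishes almost everywhere and so does the second weak derivative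
  \<open>v\<^sup>2 - 2 F'(u)\<close> of \<open>u\<^sup>2\<close>.
\<close>

lemma constant_part_critical:
  assumes F: "real_analytic F" and u: "TWS F u" and "p < q"
    and const: "\<And>x. x \<in> {p<..<q} \<Longrightarrow> u x = c"
  shows "deriv F c = 0"
proof -
  obtain v where v: "has_weak_deriv u v" "loc_integrable (\<lambda>x. (v x)\<^sup>2 - 2 * deriv F (u x))"
    "\<forall>\<phi>. test_function \<phi> \<longrightarrow> (LINT x|lborel. (u x)\<^sup>2 * deriv (deriv \<phi>) x)
        = (LINT x|lborel. ((v x)\<^sup>2 - 2 * deriv F (u x)) * \<phi> x)"
    by (rule TWS_second_weak_deriv[OF F u])
  \<comment> \<open>Shrinking the interval makes the closed supports of the test functions lie where u is constant.\<close>
  obtain p' q' where pq: "p < p'" "p' < q'" "q' < q"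
    using \<open>p < q\<close> by (meson dense)
  have flat: "(LINT x|lborel. f (u x) * deriv \<phi> x) = 0"
    if \<phi>: "test_function \<phi>" and supp: "\<And>x. x \<notin> {p'..q'} \<Longrightarrow> \<phi> x = 0" for \<phi> and f :: "real \<Rightarrow> real"
  proof -
    have "f (u x) * deriv \<phi> x = f c * deriv \<phi> x" for x
      using deriv_zero_outside_closed[of "{p'..q'}" \<phi> x] supp const[of x] pq
      by (cases "x \<in> {p'..q'}") auto
    then have "(LINT x|lborel. f (u x) * deriv \<phi> x) = (LINT x|lborel. f c * deriv \<phi> x)"
      by presburger
    then show ?thesis
      using integral_deriv_test_function[OF \<phi>] by simp
  qed
  have "AE x in lborel. x \<in> {p'<..<q'} \<longrightarrow> v x = 0"
  proof (rule fundamental_lemma_calculus_of_variations)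
    show "loc_integrable v" using v(1) by (simp add: has_weak_deriv_def)
    fix \<phi> assume \<phi>: "test_function \<phi>" "\<And>x. x \<notin> {p'<..<q'} \<Longrightarrow> \<phi> x = 0"
    have "(LINT x|lborel. u x * deriv \<phi> x) = - (LINT x|lborel. v x * \<phi> x)"
      using v(1) \<phi>(1) by (simp add: has_weak_deriv_def)
    moreover have "(LINT x|lborel. u x * deriv \<phi> x) = 0"
      by (rule flat[of \<phi> "\<lambda>y. y"]) (use \<phi> in auto)
    ultimately show "(LINT x|lborel. v x * \<phi> x) = 0" by simp
  qed
  moreover have "AE x in lborel. x \<in> {p'<..<q'} \<longrightarrow> (v x)\<^sup>2 - 2 * deriv F (u x) = 0"
  proof (rule fundamental_lemma_calculus_of_variations[OF v(2)])
    fix \<phi> assume \<phi>: "test_function \<phi>" "\<And>x. x \<notin> {p'<..<q'} \<Longrightarrow> \<phi> x = 0"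
    have "deriv \<phi> x = 0" if "x \<notin> {p'..q'}" for x
      using that by (intro deriv_zero_outside_closed[of "{p'..q'}" \<phi>] \<phi>) auto
    then show "(LINT x|lborel. ((v x)\<^sup>2 - 2 * deriv F (u x)) * \<phi> x) = 0"
      using v(3)[rule_format, OF \<phi>(1)] flat[of "deriv \<phi>" "\<lambda>y. y\<^sup>2"] test_function_deriv(2)[OF \<phi>(1)] by simp
  qed
  ultimately have "AE x in lborel. x \<in> {p'<..<q'} \<longrightarrow> deriv F c = 0"
  proof eventually_elim
    case (elim x)
    then show ?case using const[of x] pq by auto
  qed
  then show ?thesis
    using AE_lborel_ex_in_interval[OF _ pq(2)] by blast
qed

text \<open>
  A one-step Gronwall argument: on an interval of radius \<open>\<eta>\<close> with \<open>L * \<eta> \<le> 1 / 2\<close>, the maximum \<open>M\<close> of \<open>\<bar>u - c\<bar>\<close>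
  is at most \<open>L * M * \<eta> \<le> M / 2\<close>, so \<open>M = 0\<close>.
\<close>

lemma locally_constant_if_deriv_le:
  fixes u :: "real \<Rightarrow> real"
  assumes cont: "continuous_on UNIV u" and S: "countable S" and "u x0 = c" "L \<ge> 0" "\<delta> > 0"
    and deriv: "\<And>x. x \<notin> S \<Longrightarrow> \<bar>x - x0\<bar> < \<delta> \<Longrightarrow>
      \<exists>D. (u has_real_derivative D) (at x) \<and> \<bar>D\<bar> \<le> L * \<bar>u x - c\<bar>"
  obtains \<eta> where "\<eta> > 0" "\<And>x. \<bar>x - x0\<bar> \<le> \<eta> \<Longrightarrow> u x = c"
proof -
  define \<eta> where "\<eta> = min (\<delta> / 2) (1 / (2 * (L + 1)))"
  have \<eta>: "\<eta> > 0" "\<eta> < \<delta>"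
    using assms by (auto simp: \<eta>_def)
  have "L * \<eta> \<le> L * (1 / (2 * (L + 1)))"
    using \<open>L \<ge> 0\<close> by (intro mult_left_mono) (auto simp: \<eta>_def)
  also have "\<dots> \<le> 1 / 2"
    using \<open>L \<ge> 0\<close> by (simp add: field_simps)
  finally have L\<eta>: "L * \<eta> \<le> 1 / 2" .
  have "continuous_on {x0 - \<eta>..x0 + \<eta>} (\<lambda>x. \<bar>u x - c\<bar>)"
    by (intro continuous_intros continuous_on_subset[OF cont]) auto
  moreover have "{x0 - \<eta>..x0 + \<eta>} \<noteq> {}" using \<eta> by auto
  ultimately obtain x1 where x1: "x1 \<in> {x0 - \<eta>..x0 + \<eta>}"
      and max: "\<And>x. x \<in> {x0 - \<eta>..x0 + \<eta>} \<Longrightarrow> \<bar>u x - c\<bar> \<le> \<bar>u x1 - c\<bar>"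
    using continuous_attains_sup[OF compact_Icc] by blast
  define M where "M = \<bar>u x1 - c\<bar>"
  have D: "\<exists>D. (u has_real_derivative D) (at x) \<and> \<bar>D\<bar> \<le> L * M"
    if "x \<notin> S" "x \<in> {x0 - \<eta>..x0 + \<eta>}" for x
  proof -
    have "\<bar>x - x0\<bar> < \<delta>" using that \<eta> by (auto simp: abs_less_iff)
    with deriv that obtain D where "(u has_real_derivative D) (at x)" "\<bar>D\<bar> \<le> L * \<bar>u x - c\<bar>"
      by blast
    moreover have "L * \<bar>u x - c\<bar> \<le> L * M"
      unfolding M_def using max that \<open>L \<ge> 0\<close> by (intro mult_left_mono) auto
    ultimately show ?thesis by force
  qed
  have "M \<le> L * M * \<bar>x1 - x0\<bar>"
  proof (cases "x0 \<le> x1")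
    case True
    have "\<bar>u x1 - u x0\<bar> \<le> L * M * (x1 - x0)"
      using True x1 by (intro abs_increment_le_countable_exceptions[OF _ S] D
          continuous_on_subset[OF cont]) auto
    with True show ?thesis by (simp add: M_def \<open>u x0 = c\<close>)
  next
    case False
    have "\<bar>u x0 - u x1\<bar> \<le> L * M * (x0 - x1)"
      using False x1 by (intro abs_increment_le_countable_exceptions[OF _ S] D
          continuous_on_subset[OF cont]) auto
    with False show ?thesis by (simp add: M_def \<open>u x0 = c\<close> abs_minus_commute)
  qed
  also have "\<dots> \<le> L * M * \<eta>"
    using x1 \<open>L \<ge> 0\<close> by (intro mult_left_mono) (auto simp: M_def)
  also have "\<dots> = (L * \<eta>) * M" by simp
  also have "\<dots> \<le> 1 / 2 * M"
    using L\<eta> by (intro mult_right_mono) (auto simp: M_def)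
  finally have "M \<le> 0" by simp
  then have "u x = c" if "\<bar>x - x0\<bar> \<le> \<eta>" for x
    using max[of x] that by (auto simp: M_def abs_le_iff)
  with \<eta>(1) show ?thesis using that by blast
qed

text \<open>
  The set where \<open>u = c\<close> is closed and, by the Lipschitz bound on \<open>u'\<close> that the energy identity provides
  near the critical value \<open>c\<close>, open.  Positivity of \<open>c\<close> keeps the factor \<open>u\<close> in front of \<open>u'\<^sup>2\<close> away from zero.
\<close>

lemma singular_TWS_constant_if_positive_part_constant:
  assumes F: "real_analytic F" and u: "singular_TWS F u" and "p < q" "c > 0"
    and const: "\<And>x. x \<in> {p<..<q} \<Longrightarrow> u x = c"
  shows "u x = c"
proof -
  have TWS: "TWS F u" using u by (simp add: singular_TWS_def)
  then have cont: "continuous_on UNIV u"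
    by (simp add: TWS_def H1_loc_def)
  from singular_TWS_energy[OF u] obtain h S where S: "countable S"
      and off_S: "\<forall>x. x \<notin> S \<longrightarrow> (u has_real_derivative deriv u x) (at x)
        \<and> u x * (deriv u x)\<^sup>2 / 2 + F (u x) = h"
    by (elim exE conjE) (rule that)
  have D: "(u has_real_derivative deriv u x) (at x)" if "x \<notin> S" for x
    using off_S that by simp
  have energy: "u x * (deriv u x)\<^sup>2 / 2 + F (u x) = h" if "x \<notin> S" for x
    using off_S that by simp
  have crit: "deriv F c = 0"
    by (rule constant_part_critical[OF F TWS \<open>p < q\<close> const])
  have h: "h = F c"
  proof -
    obtain x where x: "p < x" "x < q" "x \<notin> S"
      by (rule countable_complement_dense[OF S \<open>p < q\<close>])
    have "\<forall>\<^sub>F s in nhds x. s \<in> {p<..<q}"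
      using x by (intro eventually_nhds_in_open) auto
    then have "\<forall>\<^sub>F s in nhds x. u s = c"
      by eventually_elim (rule const)
    then have "deriv u x = deriv (\<lambda>_. c) x"
      by (intro deriv_cong_ev) auto
    with energy[OF x(3)] const[of x] x show ?thesis by simp
  qed
  obtain C d where C: "C \<ge> 0" "d > 0" "\<And>y. \<bar>y - c\<bar> < d \<Longrightarrow> \<bar>F y - F c\<bar> \<le> C * (y - c)\<^sup>2"
    using quadratic_bound_at_critical_point[OF F crit] by blast
  define L where "L = sqrt (4 * C / c)"
  have L: "L \<ge> 0" "L\<^sup>2 = 4 * C / c"
    using C \<open>c > 0\<close> by (auto simp: L_def)
  have slope: "\<bar>deriv u x\<bar> \<le> L * \<bar>u x - c\<bar>" if "x \<notin> S" "\<bar>u x - c\<bar> < min d (c / 2)" for x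
  proof -
    have pos: "u x > c / 2" using that(2) by linarith
    have "c / 2 * (deriv u x)\<^sup>2 \<le> u x * (deriv u x)\<^sup>2"
      using pos by (intro mult_right_mono) auto
    also have "\<dots> = 2 * (F c - F (u x))"
      using energy[OF that(1)] h by simp
    also have "\<dots> \<le> 2 * (C * (u x - c)\<^sup>2)"
      using C(3)[of "u x"] that(2) by auto
    finally have "(deriv u x)\<^sup>2 \<le> 4 * C / c * (u x - c)\<^sup>2"
      using \<open>c > 0\<close> by (simp add: field_simps)
    also have "\<dots> = (L * \<bar>u x - c\<bar>)\<^sup>2"
      by (simp add: power_mult_distrib L)
    finally show ?thesis
      using L(1) by (simp add: abs_mult flip: abs_le_square_iff)
  qed
  define Z where "Z = {x. u x = c}"
  have "closed Z"
    unfolding Z_def using cont by (intro closed_Collect_eq continuous_on_const)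
  moreover have "open Z"
    unfolding open_dist
  proof
    fix x0 assume "x0 \<in> Z"
    then have x0: "u x0 = c" by (simp add: Z_def)
    have "isCont u x0" using cont by (simp add: continuous_on_eq_continuous_at)
    moreover have "min d (c / 2) > 0" using C \<open>c > 0\<close> by simp
    ultimately obtain \<delta> where \<delta>: "\<delta> > 0" "\<And>x. dist x x0 < \<delta> \<Longrightarrow> dist (u x) (u x0) < min d (c / 2)"
      unfolding continuous_at_eps_delta by metis
    have "\<exists>D. (u has_real_derivative D) (at x) \<and> \<bar>D\<bar> \<le> L * \<bar>u x - c\<bar>"
      if "x \<notin> S" "\<bar>x - x0\<bar> < \<delta>" for x
      using D[OF that(1)] slope[OF that(1)] \<delta>(2)[of x] that(2) x0 by (auto simp: dist_real_def)
    then obtain \<eta> where \<eta>: "\<eta> > 0" "\<And>x. \<bar>x - x0\<bar> \<le> \<eta> \<Longrightarrow> u x = c"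
      using locally_constant_if_deriv_le[OF cont S x0 L(1) \<delta>(1)] by metis
    then show "\<exists>e>0. \<forall>y. dist y x0 < e \<longrightarrow> y \<in> Z"
      by (intro exI[of _ \<eta>]) (auto simp: Z_def dist_real_def)
  qed
  moreover have "(p + q) / 2 \<in> Z"
    using const[of "(p + q) / 2"] \<open>p < q\<close> by (simp add: Z_def)
  ultimately have "Z = UNIV"
    using connected_clopen[of "UNIV :: real set"] by (auto simp: connected_UNIV)
  then show ?thesis by (auto simp: Z_def)
qed

lemma compactly_supported_imp_critical_at_0:
  assumes F: "real_analytic F" and u: "singular_TWS F u" and supp: "compactly_supported u"
  shows "deriv F 0 = 0"
proof -
  from supp obtain t1 t2 c where t: "t1 < t2" and c: "\<And>x. x \<notin> {t1..t2} \<Longrightarrow> u x = c"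
      and nc: "\<not> u constant_on {t1..t2}"
    unfolding compactly_supported_def constant_on_def by auto
  have TWS: "TWS F u" using u by (simp add: singular_TWS_def)
  have const: "u x = c" if "x \<in> {t2<..<t2 + 1}" for x
    using that by (intro c) auto
  have "c = 0"
  proof (rule ccontr)
    assume "c \<noteq> 0"
    moreover have "u (t2 + 1) = c" by (rule c) simp
    then have "c \<ge> 0" using TWS unfolding TWS_def by blast
    ultimately have "u x = c" for x
      by (intro singular_TWS_constant_if_positive_part_constant[OF F u _ _ const]) auto
    with nc show False by (auto simp: constant_on_def)
  qed
  with constant_part_critical[OF F TWS _ const, of t2 "t2 + 1"] show ?thesis by simp
qed


section \<open>Incompatibility of peaks and compact support\<close>

theorem corollary8:
  fixes F :: "real \<Rightarrow> real"
  assumes "real_analytic F"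
  shows "\<not> ((\<exists>u. singular_TWS F u \<and> peaked u) \<and>
             (\<exists>u. singular_TWS F u \<and> compactly_supported u)) \<and>
         (\<forall>u. singular_TWS F u \<and> peaked u \<longrightarrow> \<not> compactly_supported u) \<and>
         (\<forall>u. singular_TWS F u \<and> compactly_supported u \<longrightarrow> \<not> (\<exists>t. is_peak u t))"
proof -
  have "\<not> (singular_TWS F u \<and> is_peak u t \<and> singular_TWS F w \<and> compactly_supported w)" for u t w
    using peak_imp_deriv_neg[OF assms, of u t] compactly_supported_imp_critical_at_0[OF assms, of w]
    by auto
  moreover have "\<exists>t. is_peak u t" if "peaked u" for u
    using that unfolding peaked_def by blast
  ultimately show ?thesis by metis
qed

end
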